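(* Let $S$ be a finite set of points in the plane that is in convex position. Then there exists a plane geometric graph with vertex set $S$ whose stretch factor is at most $\frac{3+4\pi}{3}$ and whose maximum vertex degree is at most $3$.
   Context: A geometric graph on $S$ has straight-segment edges weighted by Euclidean length; $d_G(u,v)$ is the shortest-path length. Its stretch factor is the smallest $t$ with $d_G(u,v)\le t|uv|$ for all $u,v\in S$. A graph is plane if no two edges cross. *)

theory Defs
  imports "HOL-Analysis.Analysis" "HOL-Library.Extended_Real"
begin

type_synonym point = "real^2"

definition convex_position :: "point set \<Rightarrow> bool" where
  "convex_position S \<longleftrightarrow> (\<forall>p\<in>S. p \<notin> convex hull (S - {p}))"

definition geometric_graph :: "point set \<Rightarrow> point set set \<Rightarrow> bool" where
  "geometric_graph S E \<longleftrightarrow> (\<forall>e\<in>E. e \<subseteq> S \<and> card e = 2)"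

definition plane_graph :: "point set set \<Rightarrow> bool" where
  "plane_graph E \<longleftrightarrow>
     (\<forall>e1\<in>E. \<forall>e2\<in>E. e1 \<noteq> e2 \<longrightarrow> convex hull e1 \<inter> convex hull e2 \<subseteq> e1 \<inter> e2)"

definition degree :: "point set set \<Rightarrow> point \<Rightarrow> nat" where
  "degree E v = card {e\<in>E. v \<in> e}"

fun is_walk :: "point set set \<Rightarrow> point list \<Rightarrow> bool" where
  "is_walk E [] = False"
| "is_walk E [x] = True"
| "is_walk E (x # y # xs) = ({x, y} \<in> E \<and> is_walk E (y # xs))"

fun walk_length :: "point list \<Rightarrow> real" where
  "walk_length [] = 0"
| "walk_length [x] = 0"
| "walk_length (x # y # xs) = dist x y + walk_length (y # xs)"

text \<open>Shortest path distance (infinite if no path).\<close>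
definition graph_dist :: "point set set \<Rightarrow> point \<Rightarrow> point \<Rightarrow> ereal" where
  "graph_dist E u v = Inf {ereal (walk_length p) | p. is_walk E p \<and> hd p = u \<and> last p = v}"

definition stretch_factor :: "point set \<Rightarrow> point set set \<Rightarrow> ereal" where
  "stretch_factor S E = Inf {t. \<forall>u\<in>S. \<forall>v\<in>S. graph_dist E u v \<le> t * ereal (dist u v)}"

end

theory Submission
  imports Defs
begin

text \<open>
  Take a diametral pair \<open>p\<close>, \<open>q\<close>. It splits the convex polygon into an upper and a lower chain. The graph
  consists of the polygon edges together with a non-crossing matching between the two chains, built
  recursively from a closest pair \<open>a\<close>, \<open>b\<close>; so every degree is at most \<open>2 + 1\<close>.

  Each chain has stretch factor at most \<open>2\<pi>/3\<close>, because it lies in the half lens of two unit discs over \<open>pq\<close>,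
  whose boundary arc has length \<open>2\<pi>/3\<close>. If \<open>u\<close> and \<open>v\<close> lie on different chains, some matching edge \<open>ab\<close>
  separates them and satisfies \<open>|ab| \<le> |uv|\<close>; since the diagonals of a convex quadrilateral dominate opposite
  sides, \<open>|ua| + |bv| \<le> |uv| + |ab| \<le> 2|uv|\<close>, and the detour over \<open>ab\<close> costs at most
  \<open>(2 \<cdot> 2\<pi>/3 + 1)|uv|\<close>.
\<close>

subsection \<open>Length of convex chains\<close>

text \<open>The obstacle is the stretch factor of a chain: the lens bounds only the length of a
  whole chain from \<open>p\<close> to \<open>q\<close>, whereas a subchain need not lie in the lens
  over its own end points. The parts outside the subchain are therefore replaced by chords to
  \<open>p\<close> and \<open>q\<close>, along which the ends of the subchain may slide. At a
  minimum of 2*pi/3 * distance - length, the first-order condition says that an end that stops short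
  of its target has an end edge whose angle with the line through both ends has cosine at least
  3/(2*pi). If both ends stop short, all edges between inherit this bound, and projection gives the
  claim. If just one does, the total length bound 2*pi/3 is not always enough; the bound 1 + g is
  needed too, where g is the angle at which that end edge meets \<open>pq\<close>. Since
  \<open>pq\<close> is diametral, the chains are monotone in its direction, so edge directions can
  be real numbers between -pi/2 and pi/2.\<close>

lemma inner_cis_self: "(of_real r * cis x) \<bullet> cis x = r"
proof -
  have "r * cos x * cos x + r * sin x * sin x = r * ((cos x)\<^sup>2 + (sin x)\<^sup>2)"
    by (simp only: power2_eq_square distrib_left mult.assoc)
  then show ?thesis by (simp add: inner_complex_def)
qed

text \<open>This is Cauchy's formula for the length of a convex curve in terms of its support function \<open>h\<close>,
  with \<open>G\<close> an antiderivative of an upper bound of \<open>h\<close>; summation by parts replaces the integral.\<close>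

lemma chain_potential:
  fixes z :: "nat \<Rightarrow> complex" and l \<phi> :: "nat \<Rightarrow> real" and G :: "real \<Rightarrow> real"
  assumes step: "\<And>k. k < n \<Longrightarrow> z (Suc k) = z k + of_real (l k) * cis (\<phi> k)"
    and anti: "\<And>k. Suc k < n \<Longrightarrow> \<phi> (Suc k) \<le> \<phi> k"
    and range: "\<And>k. k < n \<Longrightarrow> b \<le> \<phi> k \<and> \<phi> k \<le> a" and "b \<le> a"
    and G: "\<And>k s t. k \<le> n \<Longrightarrow> b \<le> s \<Longrightarrow> s \<le> t \<Longrightarrow> t \<le> a
              \<Longrightarrow> (z k - c) \<bullet> (cis t - cis s) \<le> G t - G s"
  shows "(\<Sum>k<n. l k) \<le> G a - G b + (z n - c) \<bullet> cis b - (z 0 - c) \<bullet> cis a"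
proof -
  \<comment> \<open>\<open>\<psi> m\<close> is the direction of the edge that ends in
    \<open>z m\<close>, with \<open>a\<close> standing in before the first edge. The vertex
    \<open>z m\<close> accounts for the normals between the two edges that meet there.\<close>
  define \<psi> where "\<psi> m = (if m = 0 then a else \<phi> (m - 1))" for m
  have \<psi>: "b \<le> \<psi> m \<and> \<psi> m \<le> a" if "m \<le> n" for m
    using that range[of "m - 1"] \<open>b \<le> a\<close> by (auto simp: \<psi>_def)
  have P: "(\<Sum>k<m. l k) \<le> G a - G (\<psi> m) + (z m - c) \<bullet> cis (\<psi> m) - (z 0 - c) \<bullet> cis a"
    if "m \<le> n" for m
    using that
  proof (induction m)
    case 0
    then show ?case by (simp add: \<psi>_def)
  next
    case (Suc m)
    have le: "\<psi> (Suc m) \<le> \<psi> m"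
      using Suc.prems anti[of "m - 1"] range[of m] by (auto simp: \<psi>_def)
    have "(z m - c) \<bullet> (cis (\<psi> m) - cis (\<psi> (Suc m))) \<le> G (\<psi> m) - G (\<psi> (Suc m))"
      using G[of m "\<psi> (Suc m)" "\<psi> m"] \<psi>[of m] \<psi>[of "Suc m"] le Suc.prems by auto
    moreover have "(z (Suc m) - c) \<bullet> cis (\<psi> (Suc m)) = (z m - c) \<bullet> cis (\<psi> (Suc m)) + l m"
      using Suc.prems by (simp add: step \<psi>_def inner_diff_left inner_add_left inner_cis_self)
    ultimately show ?case
      using Suc.IH Suc.prems by (simp add: inner_diff_right)
  qed
  have "(z n - c) \<bullet> (cis (\<psi> n) - cis b) \<le> G (\<psi> n) - G b"
    using G[of n b "\<psi> n"] \<psi>[of n] by auto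
  then show ?thesis
    using P[of n] by (simp add: inner_diff_right)
qed

section \<open>Support functions and their antiderivatives\<close>

lemma support_antiderivative:
  fixes w :: complex
  assumes "\<And>x. a \<le> x \<Longrightarrow> x \<le> b \<Longrightarrow> (G has_real_derivative g x) (at x)"
    and "\<And>x. a \<le> x \<Longrightarrow> x \<le> b \<Longrightarrow> w \<bullet> (\<i> * cis x) \<le> g x"
    and "a \<le> s" "s \<le> t" "t \<le> b"
  shows "w \<bullet> (cis t - cis s) \<le> G t - G s"
proof -
  have "G s - w \<bullet> cis s \<le> G t - w \<bullet> cis t"
  proof (rule DERIV_nonneg_imp_nondecreasing[OF \<open>s \<le> t\<close>])
    fix x assume "s \<le> x" "x \<le> t"
    then have x: "a \<le> x" "x \<le> b" using assms by auto
    have "((\<lambda>x. G x - (Re w * cos x + Im w * sin x)) has_real_derivative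
            (g x - (Re w * (- sin x) + Im w * cos x))) (at x)"
      by (auto intro!: derivative_eq_intros assms(1) x)
    moreover have "g x - (Re w * (- sin x) + Im w * cos x) \<ge> 0"
      using assms(2)[OF x] by (simp add: inner_complex_def)
    ultimately show "\<exists>y. ((\<lambda>x. G x - w \<bullet> cis x) has_real_derivative y) (at x) \<and> 0 \<le> y"
      by (auto simp: inner_complex_def)
  qed
  then show ?thesis by (simp add: inner_diff_right)
qed

text \<open>Support functions change their formula where an arc meets a corner. Gluing increments
  spares a differentiability proof for the piecewise antiderivative at such points.\<close>

lemma difference_bound_glue:
  fixes f G :: "real \<Rightarrow> real"
  assumes "\<And>s t. a \<le> s \<Longrightarrow> s \<le> t \<Longrightarrow> t \<le> m \<Longrightarrow> f t - f s \<le> G t - G s"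
    and "\<And>s t. m \<le> s \<Longrightarrow> s \<le> t \<Longrightarrow> t \<le> b \<Longrightarrow> f t - f s \<le> G t - G s"
    and "a \<le> s" "s \<le> t" "t \<le> b" 
  shows "f t - f s \<le> G t - G s"
proof -
  consider "t \<le> m" | "m \<le> s" | "s \<le> m" "m \<le> t" by linarith
  then show ?thesis
  proof cases
    case 3
    then show ?thesis using assms(1)[of s m] assms(2)[of m t] assms(3-5) by linarith
  qed (use assms in auto)
qed

lemma inner_normal_le_norm: "w \<bullet> (\<i> * cis x) \<le> cmod w"
  using Cauchy_Schwarz_ineq2[of w "\<i> * cis x"] by (simp add: norm_mult)

text \<open>The derivative is the support function of the half lens over the segment from 0 to 1, in the normal
  direction \<open>\<i> cis x\<close>: first the arc centred at 0, then the apex, then the arc centred at 1.\<close>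

definition lens_antideriv :: "real \<Rightarrow> real" where
  "lens_antideriv x = (if x \<le> - pi/6 then x + pi/6 else if x \<le> pi/6 then sin (x + pi/6) else x - pi/6 + cos x)"

lemma lens_antideriv_left: "x \<le> - pi/6 \<Longrightarrow> lens_antideriv x = x + pi/6"
  by (simp add: lens_antideriv_def)

lemma lens_antideriv_right:
  assumes "pi/6 \<le> x"
  shows "lens_antideriv x = x - pi/6 + cos x"
proof -
  have x: "\<not> x \<le> - pi/6" using assms pi_gt_zero by linarith
  show ?thesis
  proof (cases "x = pi/6")
    case True
    have "lens_antideriv x = sin (x + pi/6)" unfolding lens_antideriv_def if_not_P[OF x] using True by simp
    also have "\<dots> = sqrt 3 / 2" by (simp add: True sin_60)
    finally show ?thesis by (simp add: True cos_30)
  next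
    case False
    then show ?thesis using assms unfolding lens_antideriv_def if_not_P[OF x] by simp
  qed
qed

lemma lens_support:
  assumes w: "cmod w \<le> 1" "cmod (w - 1) \<le> 1" and "- pi/2 \<le> s" "s \<le> t" "t \<le> pi/2"
  shows "w \<bullet> (cis t - cis s) \<le> lens_antideriv t - lens_antideriv s"
proof -
  have le1: "w \<bullet> (\<i> * cis x) \<le> 1" for x
    using inner_normal_le_norm[of w x] w by linarith
  have le2: "w \<bullet> (\<i> * cis x) \<le> 1 - sin x" for x
  proof -
    have "w \<bullet> (\<i> * cis x) = (w - 1) \<bullet> (\<i> * cis x) - sin x"
      by (simp add: inner_complex_def algebra_simps)
    then show ?thesis using inner_normal_le_norm[of "w - 1" x] w by linarith
  qed
  have A: "w \<bullet> cis t - w \<bullet> cis s \<le> lens_antideriv t - lens_antideriv s" if "- pi/2 \<le> s" "s \<le> t" "t \<le> - pi/6" for s t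
  proof -
    have "w \<bullet> (cis t - cis s) \<le> (t + pi/6) - (s + pi/6)"
      by (rule support_antiderivative[of "-pi/2" "-pi/6" _ "\<lambda>x. 1"])
         (use le1 that in \<open>auto intro!: derivative_eq_intros\<close>)
    then show ?thesis using that by (simp add: inner_diff_right lens_antideriv_def)
  qed
  have B: "w \<bullet> cis t - w \<bullet> cis s \<le> lens_antideriv t - lens_antideriv s" if st: "- pi/6 \<le> s" "s \<le> t" "t \<le> pi/6" for s t
  proof -
    have "w \<bullet> (cis t - cis s) \<le> sin (t + pi/6) - sin (s + pi/6)"
    proof (rule support_antiderivative[of "-pi/6" "pi/6" _ "\<lambda>x. cos (x + pi/6)"])
      fix x assume x: "- pi/6 \<le> x" "x \<le> pi/6"
      show "((\<lambda>x. sin (x + pi/6)) has_real_derivative cos (x + pi/6)) (at x)"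
        by (auto intro!: derivative_eq_intros)
      \<comment> \<open>Up to the factor sqrt 3 / 2, the normal at \<open>x\<close> is the
        combination of the normals at -pi/6 and pi/6 with these coefficients. The tangents of the
        two arcs with those normals meet in the apex \<open>cis (pi/3)\<close>.\<close>
      have s1: "sin (pi/6 - x) \<ge> 0" and s2: "sin (pi/6 + x) \<ge> 0"
        using x by (auto intro!: sin_ge_zero)
      have e: "sin (pi/6 - x) = 1/2 * cos x - sqrt 3/2 * sin x"
        "sin (pi/6 + x) = 1/2 * cos x + sqrt 3/2 * sin x"
        "cos (x + pi/6) = sqrt 3/2 * cos x - 1/2 * sin x"
        by (simp_all add: sin_diff sin_add cos_add sin_30 cos_30)
      have "w \<bullet> (\<i> * cis (-pi/6)) * sin (pi/6 - x) \<le> 1 * sin (pi/6 - x)"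
        using le1 s1 by (intro mult_right_mono) auto
      moreover have "w \<bullet> (\<i> * cis (pi/6)) * sin (pi/6 + x) \<le> 1/2 * sin (pi/6 + x)"
        using le2[of "pi/6"] s2 by (intro mult_right_mono) (auto simp: sin_30)
      moreover have "w \<bullet> (\<i> * cis (-pi/6)) * sin (pi/6 - x) + w \<bullet> (\<i> * cis (pi/6)) * sin (pi/6 + x)
          = w \<bullet> (\<i> * cis x) * sqrt 3 / 2"
        unfolding e inner_complex_def by (simp add: sin_30 cos_30 algebra_simps)
      moreover have "1 * sin (pi/6 - x) + 1/2 * sin (pi/6 + x) = cos (x + pi/6) * sqrt 3 / 2"
        unfolding e by (simp add: algebra_simps)
      ultimately have "w \<bullet> (\<i> * cis x) * sqrt 3 / 2 \<le> cos (x + pi/6) * sqrt 3 / 2"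
        by linarith
      then show "w \<bullet> (\<i> * cis x) \<le> cos (x + pi/6)"
        by simp
    qed (use st in auto)
    moreover have "lens_antideriv x = sin (x + pi/6)" if "- pi/6 \<le> x" "x \<le> pi/6" for x
      using that by (auto simp: lens_antideriv_def)
    ultimately show ?thesis using st by (simp add: inner_diff_right)
  qed
  have C: "w \<bullet> cis t - w \<bullet> cis s \<le> lens_antideriv t - lens_antideriv s" if st: "pi/6 \<le> s" "s \<le> t" "t \<le> pi/2" for s t
  proof -
    have "w \<bullet> (cis t - cis s) \<le> (t - pi/6 + cos t) - (s - pi/6 + cos s)"
      by (rule support_antiderivative[of "pi/6" "pi/2" _ "\<lambda>x. 1 - sin x"])
         (use le2 st in \<open>auto intro!: derivative_eq_intros\<close>)
    then show ?thesis using st by (simp add: inner_diff_right lens_antideriv_right)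
  qed
  have AB: "w \<bullet> cis t - w \<bullet> cis s \<le> lens_antideriv t - lens_antideriv s" if "- pi/2 \<le> s" "s \<le> t" "t \<le> pi/6" for s t
    by (rule difference_bound_glue[of "-pi/2" "-pi/6" "\<lambda>x. w \<bullet> cis x" lens_antideriv "pi/6"])
       (use A B that in auto)
  have "w \<bullet> cis t - w \<bullet> cis s \<le> lens_antideriv t - lens_antideriv s"
    by (rule difference_bound_glue[of "-pi/2" "pi/6" "\<lambda>x. w \<bullet> cis x" lens_antideriv "pi/2"])
       (use AB C assms in auto)
  then show ?thesis by (simp add: inner_diff_right)
qed

text \<open>This is a unit disc cut by a line of direction \<open>cis (- g)\<close> through its
  centre. The support point is first the corner \<open>- cis (- g)\<close>, with support
  \<open>sin (x + g)\<close>; once the normal has turned to that corner, it moves along the arc,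
  with support 1. It serves for the disc around 1 and the line of the last edge.\<close>

lemma disc_halfplane_support:
  assumes w: "cmod w \<le> 1" "w \<bullet> (\<i> * cis (-g)) \<le> 0" and g: "0 \<le> g" "g \<le> pi/2"
    and "- g \<le> s" "s \<le> t" "t \<le> pi/2"
  defines "G \<equiv> \<lambda>x. if x \<le> pi/2 - g then - cos (x + g) else x - (pi/2 - g)"
  shows "w \<bullet> (cis t - cis s) \<le> G t - G s"
proof -
  have A: "w \<bullet> cis t - w \<bullet> cis s \<le> G t - G s" if st: "- g \<le> s" "s \<le> t" "t \<le> pi/2 - g" for s t
  proof -
    have "w \<bullet> (cis t - cis s) \<le> (- cos (t + g)) - (- cos (s + g))"
    proof (rule support_antiderivative[of "-g" "pi/2 - g" _ "\<lambda>x. sin (x + g)"])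
      fix x assume x: "- g \<le> x" "x \<le> pi/2 - g"
      show "((\<lambda>x. - cos (x + g)) has_real_derivative sin (x + g)) (at x)"
        by (auto intro!: derivative_eq_intros)
      have "w \<bullet> (\<i> * cis x) = cos (x + g) * (w \<bullet> (\<i> * cis (- g))) + sin (x + g) * (w \<bullet> (\<i> * cis (pi/2 - g)))"
      proof -
        have x: "cos x = cos (x + g) * cos g + sin (x + g) * sin g"
          "sin x = sin (x + g) * cos g - cos (x + g) * sin g"
          using cos_diff[of "x + g" g] sin_diff[of "x + g" g] by simp_all
        show ?thesis
          unfolding inner_complex_def by (simp add: x sin_diff cos_diff algebra_simps del: cos_add sin_add)
      qed
      moreover have "cos (x + g) * (w \<bullet> (\<i> * cis (- g))) \<le> 0"
        using w x by (intro mult_nonneg_nonpos cos_ge_zero) auto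
      moreover have "sin (x + g) * (w \<bullet> (\<i> * cis (pi/2 - g))) \<le> sin (x + g) * 1"
        using w x inner_normal_le_norm[of w "pi/2 - g"] 
        by (intro mult_left_mono sin_ge_zero) auto
      ultimately show "w \<bullet> (\<i> * cis x) \<le> sin (x + g)" by linarith
    qed (use st in auto)
    then show ?thesis using st by (simp add: inner_diff_right G_def)
  qed
  have B: "w \<bullet> cis t - w \<bullet> cis s \<le> G t - G s" if st: "pi/2 - g \<le> s" "s \<le> t" "t \<le> pi/2" for s t
  proof -
    have "w \<bullet> (cis t - cis s) \<le> (t - (pi/2 - g)) - (s - (pi/2 - g))"
      by (rule support_antiderivative[of "pi/2 - g" "pi/2" _ "\<lambda>x. 1"])
         (use st w order_trans[OF inner_normal_le_norm] in \<open>auto intro!: derivative_eq_intros\<close>)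
    moreover have "G x = x - (pi/2 - g)" if "pi/2 - g \<le> x" for x
      using that by (auto simp: G_def)
    ultimately show ?thesis using st by (simp add: inner_diff_right)
  qed
  have "w \<bullet> cis t - w \<bullet> cis s \<le> G t - G s"
    by (rule difference_bound_glue[of "-g" "pi/2 - g" "\<lambda>x. w \<bullet> cis x" G "pi/2"])
       (use A B assms(5-7) in auto)
  then show ?thesis by (simp add: inner_diff_right)
qed

text \<open>Mirror image of \<open>disc_halfplane_support\<close> under the map from
  \<open>w\<close> to \<open>- cnj w\<close>, for the disc around 0 and the line of the first
  edge.\<close>

lemma halfplane_disc_support:
  assumes w: "cmod w \<le> 1" "w \<bullet> (\<i> * cis g) \<le> 0" and g: "0 \<le> g" "g \<le> pi/2"
    and "- pi/2 \<le> s" "s \<le> t" "t \<le> g"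
  defines "G \<equiv> \<lambda>x. if - x \<le> pi/2 - g then cos (g - x) else x + (pi/2 - g)"
  shows "w \<bullet> (cis t - cis s) \<le> G t - G s"
  using disc_halfplane_support[of "- cnj w" g "- t" "- s"] assms
  by (auto simp: inner_complex_def algebra_simps split: if_splits)

section \<open>Cones of directions and growth of the norm\<close>

lemma inner_cis_cone:
  assumes "b \<le> x" "x \<le> a" "a - b < pi" and "m \<le> z \<bullet> cis a" "m \<le> z \<bullet> cis b" "0 \<le> m"
  shows "m \<le> z \<bullet> cis x"
proof (cases "a = b")
  case True
  then show ?thesis using assms by simp
next
  case False
  \<comment> \<open>\<open>cis x\<close> is the combination of \<open>cis a\<close> and
    \<open>cis b\<close> with coefficients \<open>p\<close> and \<open>q\<close> divided by
    \<open>sin (a - b)\<close>. They are nonnegative with sum at least 1, so the lower bound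
    survives for \<open>m \<ge> 0\<close>.\<close>
  define p q where "p = sin (x - b)" and "q = sin (a - x)"
  have pq: "p \<ge> 0" "q \<ge> 0" using assms by (auto simp: p_def q_def intro!: sin_ge_zero)
  have pos: "sin (a - b) > 0" using assms False by (intro sin_gt_zero) auto
  have "sin (a - b) = q * cos (x - b) + cos (a - x) * p"
    using sin_add[of "a - x" "x - b"] by (simp add: p_def q_def)
  also have "\<dots> \<le> q * 1 + 1 * p"
    using pq by (intro add_mono mult_left_mono mult_right_mono) auto
  finally have "m * sin (a - b) \<le> m * (q + p)"
    using \<open>0 \<le> m\<close> by (intro mult_left_mono) auto
  also have "\<dots> \<le> (z \<bullet> cis a) * p + (z \<bullet> cis b) * q"
    using mult_right_mono[OF assms(4) pq(1)] mult_right_mono[OF assms(5) pq(2)]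
    by (simp add: algebra_simps)
  also have "\<dots> = (z \<bullet> cis x) * sin (a - b)"
  proof -
    have "p * cos a + q * cos b = cos x * sin (a - b)" "p * sin a + q * sin b = sin x * sin (a - b)"
      using sin_cos_squared_add[of x]
      unfolding p_def q_def sin_diff power2_eq_square by algebra+
    then show ?thesis by (simp add: inner_complex_def) algebra
  qed
  finally show ?thesis using pos by simp
qed

text \<open>First-order condition at a one-sided minimum: the right derivative of \<open>D\<close>
  times the norm along \<open>d\<close> is at least 1. Squaring and letting \<open>h\<close> tend to
  0 replaces differentiation of the norm.\<close>

lemma norm_growth_direction:
  fixes z d :: complex
  assumes "D > 0" "e > 0" "cmod d = 1"
    and grow: "\<And>h. 0 < h \<Longrightarrow> h \<le> e \<Longrightarrow> D * cmod z \<le> D * cmod (z + of_real h * d) - h"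
  shows "cmod z / D \<le> z \<bullet> d"
proof (cases "z = 0")
  case True
  then show ?thesis by simp
next
  case False
  then have r: "cmod z > 0" by simp
  have small: "cmod z / D - z \<bullet> d \<le> h" if h: "0 < h" "h \<le> e" for h
  proof -
    have "(cmod (z + of_real h * d))\<^sup>2 = (cmod z)\<^sup>2 + 2 * h * (z \<bullet> d) + h\<^sup>2"
    proof -
      have "d \<bullet> d = 1" using \<open>cmod d = 1\<close> by (simp add: dot_square_norm)
      then show ?thesis
        unfolding power2_norm_eq_inner
        by (simp add: inner_complex_def algebra_simps power2_eq_square) algebra
    qed
    moreover have "cmod z + h / D \<le> cmod (z + of_real h * d)"
      using grow[OF h] \<open>D > 0\<close> by (simp add: field_simps)
    then have "(cmod z + h / D)\<^sup>2 \<le> (cmod (z + of_real h * d))\<^sup>2"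
      using r h \<open>D > 0\<close> by (intro power_mono) auto
    ultimately have "2 * cmod z * (h / D) + (h / D)\<^sup>2 \<le> 2 * h * (z \<bullet> d) + h\<^sup>2"
      by (simp add: power2_sum)
    then have "2 * cmod z * (h / D) \<le> 2 * h * (z \<bullet> d) + h * h"
      using zero_le_power2[of "h / D"] unfolding power2_eq_square by linarith
    moreover have "2 * cmod z * (h / D) = h * (2 * (cmod z / D))" by simp
    ultimately have "h * (2 * (cmod z / D - z \<bullet> d)) \<le> h * h"
      by (simp add: algebra_simps)
    then have "2 * (cmod z / D - z \<bullet> d) \<le> h" using h by simp
    moreover have "X \<le> h" if "2 * X \<le> h" for X :: real using that h by linarith
    ultimately show ?thesis by blast
  qed
  have "cmod z / D - z \<bullet> d \<le> 0"
  proof (rule field_le_epsilon)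
    fix h :: real assume "0 < h"
    then have "cmod z / D - z \<bullet> d \<le> min e h" using \<open>e > 0\<close> by (intro small) auto
    then show "cmod z / D - z \<bullet> d \<le> 0 + h" by simp
  qed
  then show ?thesis by simp
qed

section \<open>Numerical estimates for a chain with one fixed end\<close>

lemma pi_bounds: "3141/1000 < pi" "pi < 315/100"
  using pi_approx by simp_all

text \<open>The first bound makes \<open>cos (27/25) * (2*pi/3)\<close> less than 1. In the second,
  1839/1000 is a lower bound of the square root of (2*pi/3)^2 - 1, and 52/25 is 1 + 27/25. The
  cosine comes from the sine at half the angle, so one Taylor polynomial serves both.\<close>

lemma sin_cos_27_25_bounds:
  "cos (27/25::real) < 473/1000" "cos (27/25::real) + 1839/1000 * sin (27/25) \<ge> 52/25"
proof -
  have s: "\<bar>sin x - (x - x^3/6 + x^5/120)\<bar> \<le> x^7/5040" if "x \<ge> 0" for x :: real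
  proof -
    have "(\<Sum>m<7. sin_coeff m * x ^ m) = x - x^3/6 + x^5/120"
      by (simp add: lessThan_nat_numeral sin_coeff_def fact_numeral)
    then show ?thesis
      using Maclaurin_sin_bound[of x 7] that by (simp add: fact_numeral)
  qed
  have lo: "x - x^3/6 + x^5/120 - x^7/5040 \<le> sin x"
    and up: "sin x \<le> x - x^3/6 + x^5/120 + x^7/5040" if "x \<ge> 0" for x :: real
    using s[OF that] unfolding abs_le_iff by linarith+
  have s1: "8819/10000 \<le> sin (27/25::real)"
    using lo[of "27/25"] by (simp add: power_divide)
  have s2: "5141/10000 \<le> sin (27/50::real)" "sin (27/50::real) \<le> 5142/10000"
    using lo[of "27/50"] up[of "27/50"] by (simp_all add: power_divide)
  have c: "cos (27/25::real) = 1 - 2 * (sin (27/50))\<^sup>2"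
    using cos_double_sin[of "27/50::real"] by simp
  have "(5141/10000)\<^sup>2 \<le> (sin (27/50::real))\<^sup>2"
    using s2(1) by (rule power_mono) simp
  moreover have "(sin (27/50::real))\<^sup>2 \<le> (5142/10000)\<^sup>2"
    using s2 by (intro power_mono) linarith+
  ultimately show "cos (27/25::real) < 473/1000" "cos (27/25::real) + 1839/1000 * sin (27/25) \<ge> 52/25"
    using s1 c by (simp_all add: power_divide)
qed

text \<open>This settles chains that start at \<open>p = 0\<close> and end at a point \<open>1 - r cis (-g)\<close> on the last ray towards \<open>q = 1\<close>.
  The threshold \<open>27/25\<close> for \<open>g\<close> lies between \<open>arccos (3/(2\<pi>))\<close>, beyond which projecting to the axis suffices, and
  the positive zero of the concave function \<open>cos g + sin g \<cdot> sqrt ((2\<pi>/3)\<^sup>2 - 1) - 1 - g\<close>.\<close>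

lemma lune_tail_bound:
  assumes g: "0 \<le> g" "g < pi/2" and r: "0 \<le> r" and L: "L \<le> 2*pi/3" "L \<le> 1 + g"
  shows "L - r \<le> 2*pi/3 * cmod (1 - of_real r * cis (- g))"
proof (cases "g \<le> 27/25")
  case False
  have "cos g \<le> cos (27/25)"
    using False g by (intro cos_monotone_0_pi_le) auto
  then have "cos g * (2*pi/3) \<le> 473/1000 * (21/10)"
    using sin_cos_27_25_bounds pi_bounds g by (intro mult_mono cos_ge_zero) auto
  then have "cos g * (2*pi/3) * r \<le> 1 * r"
    using r by (intro mult_right_mono) auto
  moreover have "1 - r * cos g \<le> cmod (1 - of_real r * cis (- g))"
    using complex_Re_le_cmod[of "1 - of_real r * cis (- g)"] by simp
  then have "2*pi/3 * (1 - r * cos g) \<le> 2*pi/3 * cmod (1 - of_real r * cis (- g))"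
    by (intro mult_left_mono) auto
  ultimately show ?thesis using L by (simp add: algebra_simps)
next
  case True
  define k where "k x = 1 + x - cos x - 1839/1000 * sin x" for x :: real
  have "convex_on {0..27/25} k"
  proof (rule f''_ge0_imp_convex)
    fix x :: real assume x: "x \<in> {0..27/25}"
    show "(k has_real_derivative (1 + sin x - 1839/1000 * cos x)) (at x)"
      unfolding k_def by (auto intro!: derivative_eq_intros)
    show "((\<lambda>x. 1 + sin x - 1839/1000 * cos x) has_real_derivative (cos x + 1839/1000 * sin x)) (at x)"
      by (auto intro!: derivative_eq_intros)
    have "x \<le> pi/2" using x pi_bounds by auto
    then show "0 \<le> cos x + 1839/1000 * sin x"
      using x by (intro add_nonneg_nonneg mult_nonneg_nonneg cos_ge_zero sin_ge_zero) auto
  qed auto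
  then have "k ((1 - g / (27/25)) *\<^sub>R 0 + (g / (27/25)) *\<^sub>R (27/25)) \<le> (1 - g / (27/25)) * k 0 + (g / (27/25)) * k (27/25)"
    by (rule convex_onD) (use g True in auto)
  moreover have "k 0 = 0" "k (27/25) \<le> 0" using sin_cos_27_25_bounds by (auto simp: k_def)
  then have "(1 - g / (27/25)) * k 0 + (g / (27/25)) * k (27/25) \<le> 0"
    using g by (simp add: mult_nonneg_nonpos)
  ultimately have kg: "1 + g \<le> cos g + 1839/1000 * sin g" by (simp add: k_def)
  \<comment> \<open>\<open>v\<close> is the distance of 0 from the last ray, and \<open>u\<close>
    locates the end point on that ray relative to the foot of the perpendicular. The rest is
    Cauchy-Schwarz for (1839/1000, -1) and (v, u).\<close>
  define u v where "u = r - cos g" and "v = sin g"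
  have v: "v \<ge> 0" using g by (auto simp: v_def intro!: sin_ge_zero)
  have mod2: "(cmod (1 - of_real r * cis (- g)))\<^sup>2 = u\<^sup>2 + v\<^sup>2"
    using sin_cos_squared_add[of g] unfolding u_def v_def cmod_power2
    by (simp add: power2_eq_square) algebra
  have "(1839/1000 * v - u)\<^sup>2 \<le> ((1839/1000)\<^sup>2 + 1) * (u\<^sup>2 + v\<^sup>2)"
    using zero_le_power2[of "v + 1839/1000 * u"] by (simp add: power2_eq_square algebra_simps)
  also have "\<dots> \<le> (2*pi/3)\<^sup>2 * (u\<^sup>2 + v\<^sup>2)"
  proof (rule mult_right_mono)
    have "(2094/1000::real)\<^sup>2 \<le> (2*pi/3)\<^sup>2" using pi_bounds by (intro power_mono) auto
    then show "(1839/1000)\<^sup>2 + 1 \<le> (2*pi/3)\<^sup>2" by (simp add: power2_eq_square)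
  qed auto
  also have "\<dots> = (2*pi/3 * cmod (1 - of_real r * cis (- g)))\<^sup>2"
    by (simp only: power_mult_distrib mod2)
  finally have "1839/1000 * v - u \<le> 2*pi/3 * cmod (1 - of_real r * cis (- g))"
    by (rule power2_le_imp_le) auto
  then show ?thesis using kg L by (simp add: u_def v_def)
qed

text \<open>The chain \<open>z 0, ..., z n\<close> is extended to a concave chain from 0 to 1 by a first edge of length \<open>s\<close> and
  direction \<open>a\<close> and a last edge of length \<open>t\<close> and direction \<open>b\<close>.\<close>

locale lens_chain =
  fixes n :: nat and z :: "nat \<Rightarrow> complex" and l \<phi> :: "nat \<Rightarrow> real" and a b s t :: real
  assumes step: "\<And>k. k < n \<Longrightarrow> z (Suc k) = z k + of_real (l k) * cis (\<phi> k)"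
    and l_nonneg: "\<And>k. k < n \<Longrightarrow> 0 \<le> l k"
    and anti: "\<And>k. Suc k < n \<Longrightarrow> \<phi> (Suc k) \<le> \<phi> k"
    and between: "\<And>k. k < n \<Longrightarrow> b \<le> \<phi> k \<and> \<phi> k \<le> a"
    and ba: "b \<le> a" "- pi/2 < b" "a < pi/2"
    and st: "0 \<le> s" "0 \<le> t"
    and first: "z 0 = of_real s * cis a"
    and last: "z n + of_real t * cis b = 1"
    and lens: "\<And>k. k \<le> n \<Longrightarrow> cmod (z k) \<le> 1 \<and> cmod (z k - 1) \<le> 1"
begin

definition "L = (\<Sum>k<n. l k)"

lemma z0: "(z 0 - c) \<bullet> cis a = s - c \<bullet> cis a"
  by (simp add: first inner_diff_left inner_cis_self)

lemma zn: "(z n - c) \<bullet> cis b = (1 - c) \<bullet> cis b - t"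
proof -
  have "z n = 1 - of_real t * cis b" using last by (simp add: algebra_simps)
  then show ?thesis by (simp add: inner_diff_left inner_cis_self)
qed

text \<open>Because 0 and 1 lie on the lines of the two end edges, the boundary terms of
  \<open>chain_potential\<close> absorb the lengths \<open>s\<close> and \<open>t\<close> exactly.
  What remains depends only on the centre \<open>c\<close>, which will be 0 or 1.\<close>

lemma potential:
  assumes "\<And>k x y. k \<le> n \<Longrightarrow> b \<le> x \<Longrightarrow> x \<le> y \<Longrightarrow> y \<le> a
              \<Longrightarrow> (z k - c) \<bullet> (cis y - cis x) \<le> G y - G x"
  shows "s + L + t \<le> G a - G b + (1 - c) \<bullet> cis b + c \<bullet> cis a"
  using chain_potential[of n z l \<phi> b a c G, OF step anti between ba(1) assms] zn[of c] z0[of c]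
  by (simp add: L_def)

text \<open>Concavity keeps the chain below the line of the last edge, the half-plane required by
  \<open>disc_halfplane_support\<close>. The induction runs backwards from
  \<open>z n\<close>.\<close>

lemma z_tail: "k \<le> n \<Longrightarrow> (z k - 1) \<bullet> (\<i> * cis b) \<le> 0"
proof (induction "n - k" arbitrary: k)
  case 0
  then have "z k = 1 - of_real t * cis b" using last by (simp add: algebra_simps)
  then show ?case by (simp add: inner_complex_def)
next
  case (Suc m)
  then have k: "k < n" by simp
  have "0 \<le> l k * sin (\<phi> k - b)"
    using l_nonneg[OF k] between[OF k] ba by (intro mult_nonneg_nonneg sin_ge_zero) auto
  moreover have "(z (Suc k) - 1) \<bullet> (\<i> * cis b) \<le> 0" using Suc by simp
  ultimately show ?case
    by (simp add: step[OF k] inner_complex_def sin_diff algebra_simps)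
qed

lemma z_head: "k \<le> n \<Longrightarrow> z k \<bullet> (\<i> * cis a) \<le> 0"
proof (induction k)
  case 0
  then show ?case by (simp add: first inner_complex_def)
next
  case (Suc k)
  then have k: "k < n" by simp
  have "0 \<le> l k * sin (a - \<phi> k)"
    using l_nonneg[OF k] between[OF k] ba by (intro mult_nonneg_nonneg sin_ge_zero) auto
  then show ?case using Suc
    by (simp add: step[OF k] inner_complex_def sin_diff algebra_simps)
qed

lemma full_le_lens: "s + L + t \<le> 2*pi/3"
proof -
  have "s + L + t \<le> lens_antideriv a - lens_antideriv b + (1 - 0) \<bullet> cis b + 0 \<bullet> cis a"
    by (rule potential) (use lens ba in \<open>auto intro!: lens_support\<close>)
  \<comment> \<open>The end points 0 and 1 lie in the lens too. They extend the range of directions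
    from [b, a] to [-pi/2, pi/2] and cancel the boundary term.\<close>
  moreover have "0 \<bullet> (cis (pi/2) - cis a) \<le> lens_antideriv (pi/2) - lens_antideriv a"
    by (rule lens_support) (use ba in auto)
  moreover have "1 \<bullet> (cis b - cis (- pi/2)) \<le> lens_antideriv b - lens_antideriv (- pi/2)"
    by (rule lens_support) (use ba in auto)
  moreover have "lens_antideriv (pi/2) - lens_antideriv (-pi/2) = 2*pi/3"
  proof -
    have "- pi/2 \<le> - pi/6" "pi/6 \<le> pi/2" using pi_gt_zero by linarith+
    then show ?thesis by (simp add: lens_antideriv_left lens_antideriv_right)
  qed
  ultimately show ?thesis by (simp add: inner_complex_def)
qed

text \<open>The extremal chain follows the unit circle around 1 from 0 through the angle
  \<open>- b\<close>, up to the line of the last edge, and then a radius to 1.\<close>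

lemma full_le_last_angle:
  assumes "b \<le> 0"
  shows "s + L + t \<le> 1 - b"
proof -
  define g where "g = - b"
  define G where "G x = (if x \<le> pi/2 - g then - cos (x + g) else x - (pi/2 - g))" for x
  have supp: "w \<bullet> (cis y - cis x) \<le> G y - G x"
    if "cmod w \<le> 1" "w \<bullet> (\<i> * cis b) \<le> 0" "b \<le> x" "x \<le> y" "y \<le> pi/2" for w x y
    using disc_halfplane_support[of w g x y] that assms ba by (auto simp: g_def G_def)
  have "s + L + t \<le> G a - G b + (1 - 1) \<bullet> cis b + 1 \<bullet> cis a"
    by (rule potential) (use lens ba z_tail in \<open>auto intro!: supp\<close>)
  moreover have "(0 - 1) \<bullet> (cis (pi/2) - cis a) \<le> G (pi/2) - G a"
  proof (rule supp)
    have "sin b \<le> 0" using sin_ge_zero[of "- b"] assms ba by simp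
    then show "(0 - 1) \<bullet> (\<i> * cis b) \<le> 0" by (simp add: inner_complex_def)
  qed (use ba in auto)
  moreover have "G (pi/2) - G b = 1 + g"
    using assms ba by (auto simp: G_def g_def)
  ultimately show ?thesis by (simp add: inner_complex_def g_def)
qed

lemma full_le_first_angle:
  assumes "0 \<le> a"
  shows "s + L + t \<le> 1 + a"
proof -
  define G where "G x = (if - x \<le> pi/2 - a then cos (a - x) else x + (pi/2 - a))" for x
  have supp: "w \<bullet> (cis y - cis x) \<le> G y - G x"
    if "cmod w \<le> 1" "w \<bullet> (\<i> * cis a) \<le> 0" "- pi/2 \<le> x" "x \<le> y" "y \<le> a" for w x y
    using halfplane_disc_support[of w a x y] that assms ba by (auto simp: G_def)
  have "s + L + t \<le> G a - G b + (1 - 0) \<bullet> cis b + 0 \<bullet> cis a"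
    by (rule potential) (use lens ba z_head in \<open>auto intro!: supp\<close>)
  moreover have "1 \<bullet> (cis b - cis (- pi/2)) \<le> G b - G (- pi/2)"
  proof (rule supp)
    have "sin a \<ge> 0" using assms ba by (intro sin_ge_zero) auto
    then show "1 \<bullet> (\<i> * cis a) \<le> 0" by (simp add: inner_complex_def)
  qed (use ba in auto)
  moreover have "G a - G (- pi/2) = 1 + a"
    using assms ba by (auto simp: G_def)
  ultimately show ?thesis by (simp add: inner_complex_def)
qed

lemma displacement:
  "m \<le> n \<Longrightarrow> (z m - z 0) \<bullet> w = (\<Sum>k<m. l k * (w \<bullet> cis (\<phi> k)))"
proof (induction m)
  case (Suc m)
  then show ?case
    by (simp add: step inner_diff_left inner_add_left) (simp add: inner_complex_def algebra_simps)
qed auto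

text \<open>All edge directions lie between \<open>b\<close> and \<open>a\<close>, so by
  \<open>inner_cis_cone\<close> every edge contributes at least \<open>cmod w / D\<close> per unit
  length to the inner product with \<open>w\<close>. Summing compares the total length with
  \<open>w \<bullet> w\<close>.\<close>

lemma interior_bound:
  assumes xy: "0 \<le> x" "0 \<le> y"
  defines "w \<equiv> (z n + of_real y * cis b) - (z 0 - of_real x * cis a)"
  assumes D: "D > 0" and wa: "cmod w / D \<le> w \<bullet> cis a" and wb: "cmod w / D \<le> w \<bullet> cis b"
  shows "x + L + y \<le> D * cmod w"
proof -
  have expand: "w \<bullet> v = x * (v \<bullet> cis a) + (\<Sum>k<n. l k * (v \<bullet> cis (\<phi> k))) + y * (v \<bullet> cis b)" for v
    using displacement[of n v]
    by (simp add: w_def inner_diff_left inner_add_left) (simp add: inner_complex_def algebra_simps)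
  have lower: "m * (x + L + y) \<le> w \<bullet> v"
    if m: "m \<ge> 0" "m \<le> v \<bullet> cis a" "m \<le> v \<bullet> cis b" for m v
  proof -
    have "m * L \<le> (\<Sum>k<n. l k * (v \<bullet> cis (\<phi> k)))"
      unfolding L_def sum_distrib_left
    proof (rule sum_mono)
      fix k assume "k \<in> {..<n}"
      then have k: "k < n" by simp
      have "m \<le> v \<bullet> cis (\<phi> k)"
        by (rule inner_cis_cone[of b _ a]) (use between[OF k] ba m in auto)
      then show "m * l k \<le> l k * (v \<bullet> cis (\<phi> k))"
        using mult_left_mono[OF _ l_nonneg[OF k]] by (simp add: mult.commute[of m])
    qed
    moreover have "m * x \<le> x * (v \<bullet> cis a)" "m * y \<le> y * (v \<bullet> cis b)"
      using mult_left_mono[OF m(2) xy(1)] mult_left_mono[OF m(3) xy(2)]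
      by (simp_all add: mult.commute[of m])
    ultimately show ?thesis by (simp add: expand algebra_simps)
  qed
  show ?thesis
  proof (cases "w = 0")
    case False
    have "cmod w / D * (x + L + y) \<le> w \<bullet> w"
      by (rule lower) (use D wa wb in auto)
    also have "w \<bullet> w = cmod w * cmod w" by (simp add: dot_square_norm power2_eq_square)
    finally have "cmod w * (x + L + y) \<le> cmod w * (D * cmod w)" using D by (simp add: field_simps)
    then show ?thesis using False by simp
  next
    case True
    \<comment> \<open>For \<open>w = 0\<close> projecting to \<open>w\<close> says nothing. The real
      axis serves instead: all directions have positive cosine, which forces the length to be at
      most 0.\<close>
    define m where "m = min (cos a) (cos b)"
    have "m > 0" unfolding m_def using ba by (auto intro!: cos_gt_zero_pi)
    moreover have "m * (x + L + y) \<le> w \<bullet> 1"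
      by (rule lower) (use \<open>m > 0\<close> in \<open>auto simp: m_def inner_complex_def\<close>)
    ultimately have "x + L + y \<le> 0" using True by (simp add: mult_le_0_iff)
    then show ?thesis using True by simp
  qed
qed

text \<open>Slide the two ends of the chain outwards along the first and last edges to minimize
  \<open>2\<pi>/3 \<cdot> distance - length\<close>. If neither slid end reaches 0 or 1, minimality bounds the angles at both
  ends; otherwise the lens bounds apply.\<close>

lemma stretch:
  assumes Im: "0 \<le> Im (z 0)" "0 \<le> Im (z n)"
  shows "L \<le> 2*pi/3 * cmod (z n - z 0)"
proof -
  define W where "W p = (z n + of_real (snd p) * cis b) - (z 0 - of_real (fst p) * cis a)" for p :: "real \<times> real"
  define F where "F p = 2*pi/3 * cmod (W p) - (fst p + L + snd p)" for p :: "real \<times> real"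
  have "continuous_on ({0..s} \<times> {0..t}) F"
    unfolding F_def W_def by (intro continuous_intros)
  moreover have "compact ({0..s} \<times> {0..t})" by (intro compact_Times) auto
  moreover have "{0..s} \<times> {0..t} \<noteq> {}" using st by auto
  ultimately obtain p where p: "p \<in> {0..s} \<times> {0..t}"
    and min: "\<And>r. r \<in> {0..s} \<times> {0..t} \<Longrightarrow> F p \<le> F r"
    using continuous_attains_inf by metis
  obtain x y where xy: "p = (x, y)" "0 \<le> x" "x \<le> s" "0 \<le> y" "y \<le> t" using p by auto
  have end1: "z 0 - of_real x * cis a = of_real (s - x) * cis a"
    by (simp add: first algebra_simps)
  have end2: "z n + of_real y * cis b = 1 - of_real (t - y) * cis b"
    using last by (simp add: algebra_simps)
  have "0 \<le> F p"
  proof -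
    consider "x = s" "y = t" | "x = s" "y < t" | "x < s" "y = t" | "x < s" "y < t" using xy by linarith
    then show ?thesis
    proof cases
      case 1
      then have "W p = 1" using end1 end2 by (simp add: W_def xy)
      then show ?thesis using full_le_lens by (simp add: F_def xy 1)
    next
      case 2
      \<comment> \<open>The last edge leads from \<open>z n\<close>, which is not below the axis, to
        1, so it does not ascend and \<open>- b\<close> is an admissible angle for
        \<open>lune_tail_bound\<close>.\<close>
      have "t * sin b \<le> 0" using last Im by (simp add: complex_eq_iff)
      then have "sin b \<le> 0" using 2 xy by (simp add: mult_le_0_iff)
      then have b: "b \<le> 0" using ba sin_gt_zero[of b] by force
      have "s + L + t - (t - y) \<le> 2*pi/3 * cmod (1 - of_real (t - y) * cis (- (- b)))"
        by (rule lune_tail_bound) (use 2 b ba full_le_lens full_le_last_angle in auto)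
      moreover have "W p = 1 - of_real (t - y) * cis (- (- b))"
        using end1 end2 2 by (simp add: W_def xy)
      ultimately show ?thesis by (simp add: F_def xy 2)
    next
      case 3
      have "0 \<le> s * sin a" using first Im by (simp add: complex_eq_iff)
      then have "0 \<le> sin a" using 3 xy by (simp add: zero_le_mult_iff)
      then have a: "0 \<le> a" using ba sin_gt_zero[of "- a"] by force
      have "s + L + t - (s - x) \<le> 2*pi/3 * cmod (1 - of_real (s - x) * cis (- a))"
        by (rule lune_tail_bound) (use 3 a ba full_le_lens full_le_first_angle in auto)
      moreover have "W p = cnj (1 - of_real (s - x) * cis (- a))"
        using end1 end2 3 by (simp add: W_def xy cis_cnj)
      then have "cmod (W p) = cmod (1 - of_real (s - x) * cis (- a))"
        by (metis complex_mod_cnj)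
      ultimately show ?thesis by (simp add: F_def xy 3)
    next
      case 4
      have "cmod (W p) / (2*pi/3) \<le> W p \<bullet> cis b"
      proof (rule norm_growth_direction)
        fix h assume h: "0 < h" "h \<le> t - y"
        have "W (x, y + h) = W p + of_real h * cis b" by (simp add: W_def xy algebra_simps)
        then show "2*pi/3 * cmod (W p) \<le> 2*pi/3 * cmod (W p + of_real h * cis b) - h"
          using min[of "(x, y + h)"] h xy by (simp add: F_def)
      qed (use 4 in auto)
      moreover have "cmod (W p) / (2*pi/3) \<le> W p \<bullet> cis a"
      proof (rule norm_growth_direction)
        fix h assume h: "0 < h" "h \<le> s - x"
        have "W (x + h, y) = W p + of_real h * cis a" by (simp add: W_def xy algebra_simps)
        then show "2*pi/3 * cmod (W p) \<le> 2*pi/3 * cmod (W p + of_real h * cis a) - h"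
          using min[of "(x + h, y)"] h xy by (simp add: F_def)
      qed (use 4 in auto)
      ultimately have "x + L + y \<le> 2*pi/3 * cmod (W p)"
        using interior_bound[of x y "2*pi/3"] xy by (simp add: W_def)
      then show ?thesis by (simp add: F_def xy)
    qed
  qed
  \<comment> \<open>(0, 0) is the chain before sliding.\<close>
  also have "F p \<le> F (0, 0)" using min st by auto
  finally show ?thesis by (simp add: F_def W_def)
qed

end

section \<open>From point sequences to edge directions\<close>

definition direction :: "complex \<Rightarrow> complex \<Rightarrow> real" where
  "direction u v = arctan ((Im v - Im u) / (Re v - Re u))"

lemma direction_bounds: "- pi/2 < direction u v" "direction u v < pi/2"
  using arctan_bounded[of "(Im v - Im u) / (Re v - Re u)"] by (simp_all add: direction_def)

lemma along_direction:
  assumes "Re u < Re v"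
  shows "v = u + of_real (cmod (v - u)) * cis (direction u v)"
proof -
  define x y where "x = Re v - Re u" and "y = Im v - Im u"
  have x: "x > 0" using assms by (simp add: x_def)
  have "cmod (v - u) = sqrt (x\<^sup>2 + y\<^sup>2)" by (simp add: cmod_def x_def y_def)
  also have "x\<^sup>2 + y\<^sup>2 = x\<^sup>2 * (1 + (y / x)\<^sup>2)" using x by (simp add: field_simps)
  also have "sqrt \<dots> = x * sqrt (1 + (y / x)\<^sup>2)" using x by (simp add: real_sqrt_mult)
  finally have "cmod (v - u) = x * sqrt (1 + (y / x)\<^sup>2)" .
  moreover have "sqrt (1 + (y / x)\<^sup>2) > 0" by (simp add: add_pos_nonneg)
  ultimately have "cmod (v - u) * cos (arctan (y / x)) = x" "cmod (v - u) * sin (arctan (y / x)) = y"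
    using x by (simp_all add: cos_arctan sin_arctan)
  then show ?thesis
    unfolding direction_def x_def[symmetric] y_def[symmetric]
    by (simp add: complex_eq_iff x_def y_def)
qed

lemma concave_chain_stretch:
  fixes w :: "nat \<Rightarrow> complex"
  assumes ends: "w 0 = 0" "w n = 1"
    and mono: "\<And>i j. i < j \<Longrightarrow> j \<le> n \<Longrightarrow> Re (w i) < Re (w j)"
    and concave: "\<And>i j k. i < j \<Longrightarrow> j < k \<Longrightarrow> k \<le> n \<Longrightarrow>
        (Im (w k) - Im (w j)) * (Re (w j) - Re (w i)) \<le> (Im (w j) - Im (w i)) * (Re (w k) - Re (w j))"
    and Im: "\<And>k. k \<le> n \<Longrightarrow> 0 \<le> Im (w k)"
    and lens: "\<And>k. k \<le> n \<Longrightarrow> cmod (w k) \<le> 1 \<and> cmod (w k - 1) \<le> 1"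
    and ij: "i \<le> j" "j \<le> n"
  shows "(\<Sum>k=i..<j. cmod (w (Suc k) - w k)) \<le> 2*pi/3 * cmod (w j - w i)"
proof (cases "i = j")
  case False
  then have "i < j" using ij by simp
  have dir3: "direction (w q) (w r) \<le> direction (w p) (w q)" if "p < q" "q < r" "r \<le> n" for p q r
    using concave[OF that] mono[of p q] mono[of q r] that
    by (simp add: direction_def arctan_le_iff divide_le_eq le_divide_eq field_simps)
  have dir: "direction (w r) (w s) \<le> direction (w p) (w q)" if "p < q" "q \<le> r" "r < s" "s \<le> n" for p q r s
    using dir3[of p q r] dir3[of q r s] dir3[of p q s] that by (cases "q = r") auto
  define \<phi> where "\<phi> k = direction (w (i + k)) (w (Suc (i + k)))" for k
  define l where "l k = cmod (w (Suc (i + k)) - w (i + k))" for k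
  \<comment> \<open>The end edges are the chords from \<open>w 0\<close> to \<open>w i\<close> and
    from \<open>w j\<close> to \<open>w n\<close>. A chord of length 0 has no direction of its own
    and borrows that of the adjacent edge.\<close>
  define a where "a = (if i = 0 then \<phi> 0 else direction (w 0) (w i))"
  define b where "b = (if j = n then \<phi> (j - i - 1) else direction (w j) (w n))"
  have \<phi>: "\<phi> k \<le> a" "b \<le> \<phi> k" if "k < j - i" for k
  proof -
    show "\<phi> k \<le> a"
    proof (cases "i = 0")
      case True
      then show ?thesis using dir[of i "Suc i" "i + k" "Suc (i + k)"] that ij
        by (cases "k = 0") (auto simp: a_def \<phi>_def)
    next
      case False
      then show ?thesis using dir[of 0 i "i + k" "Suc (i + k)"] that ij by (auto simp: a_def \<phi>_def)
    qed
    show "b \<le> \<phi> k"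
    proof (cases "j = n")
      case True
      then show ?thesis using dir[of "i + k" "Suc (i + k)" "j - 1" j] that ij
        by (cases "k = j - i - 1") (auto simp: b_def \<phi>_def)
    next
      case False
      then show ?thesis using dir[of "i + k" "Suc (i + k)" j n] that ij by (auto simp: b_def \<phi>_def)
    qed
  qed
  interpret lens_chain "j - i" "\<lambda>k. w (i + k)" l \<phi> a b "cmod (w i)" "cmod (1 - w j)"
  proof
    show "w (i + Suc k) = w (i + k) + of_real (l k) * cis (\<phi> k)" if "k < j - i" for k
      using along_direction[of "w (i + k)" "w (Suc (i + k))"] mono[of "i + k" "Suc (i + k)"] that ij
      by (simp add: l_def \<phi>_def)
    show "\<phi> (Suc k) \<le> \<phi> k" if "Suc k < j - i" for k
      using dir[of "i + k" "Suc (i + k)" "Suc (i + k)" "Suc (Suc (i + k))"] that ij by (simp add: \<phi>_def)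
    show "b \<le> a" using \<phi>[of 0] \<open>i < j\<close> by simp
    show "- pi/2 < b" "a < pi/2" by (simp_all only: a_def b_def \<phi>_def direction_bounds split: if_splits) simp_all
    show "w (i + 0) = of_real (cmod (w i)) * cis a"
      using along_direction[of "w 0" "w i"] mono[of 0 i] ends ij by (cases "i = 0") (auto simp: a_def)
    show "w (i + (j - i)) + of_real (cmod (1 - w j)) * cis b = 1"
      using along_direction[of "w j" "w n"] mono[of j n] ends ij by (cases "j = n") (auto simp: b_def)
  qed (use \<phi> lens ij in \<open>auto simp: l_def\<close>)
  have "L = (\<Sum>k=i..<j. cmod (w (Suc k) - w k))"
    unfolding L_def l_def
    by (rule sum.reindex_bij_witness[of _ "\<lambda>k. k - i" "\<lambda>k. i + k"]) auto
  then show ?thesis using stretch Im ij by simp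
qed auto

subsection \<open>Closest-pair matchings\<close>

text \<open>Given a closest pair \<open>(a, b)\<close>, the recursion treats the pairs strictly to
  the left of both \<open>a\<close> and \<open>b\<close> and those strictly to the right of both.
  Every other pair is separated by \<open>(a, b)\<close> in the order of \<open>f\<close>, and
  \<open>d a b\<close> is minimal. The strict order in both components says at once that two chosen
  pairs share no end point and do not cross.\<close>

lemma closest_pair_matching:
  fixes f :: "'a \<Rightarrow> real" and d :: "'a \<Rightarrow> 'a \<Rightarrow> real"
  assumes "finite A" "finite B"
  shows "\<exists>M \<subseteq> A \<times> B.
     (\<forall>a b a' b'. (a,b) \<in> M \<longrightarrow> (a',b') \<in> M \<longrightarrow> (a,b) \<noteq> (a',b') \<longrightarrow>
        f a < f a' \<and> f b < f b' \<or> f a' < f a \<and> f b' < f b) \<and>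
     (\<forall>u\<in>A. \<forall>v\<in>B. \<exists>a b. (a,b) \<in> M \<and> d a b \<le> d u v \<and> (f u \<le> f a \<and> f b \<le> f v \<or> f a \<le> f u \<and> f v \<le> f b))"
  using assms
proof (induction A arbitrary: B rule: finite_psubset_induct)
  case (psubset A)
  show ?case
  proof (cases "A = {} \<or> B = {}")
    case True
    then show ?thesis by (intro exI[of _ "{}"]) auto
  next
    case False
    then have "finite (A \<times> B)" "A \<times> B \<noteq> {}" using psubset by auto
    then have "Min ((\<lambda>(u,v). d u v) ` (A \<times> B)) \<in> (\<lambda>(u,v). d u v) ` (A \<times> B)"
      by (intro Min_in) auto
    then obtain a b where ab: "a \<in> A" "b \<in> B" and "d a b = Min ((\<lambda>(u,v). d u v) ` (A \<times> B))"
      by auto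
    then have closest: "d a b \<le> d u v" if "u \<in> A" "v \<in> B" for u v
      using \<open>finite (A \<times> B)\<close> that by (auto intro!: Min_le)
    have sub: "{u\<in>A. f u < f a} \<subset> A" "{u\<in>A. f a < f u} \<subset> A" using ab by auto
    have fin: "finite {v\<in>B. f v < f b}" "finite {v\<in>B. f b < f v}" using psubset.prems by auto
    obtain Ml where Ml: "Ml \<subseteq> {u\<in>A. f u < f a} \<times> {v\<in>B. f v < f b}"
      "\<forall>a b a' b'. (a,b) \<in> Ml \<longrightarrow> (a',b') \<in> Ml \<longrightarrow> (a,b) \<noteq> (a',b') \<longrightarrow>
        f a < f a' \<and> f b < f b' \<or> f a' < f a \<and> f b' < f b"
      "\<forall>u\<in>{u\<in>A. f u < f a}. \<forall>v\<in>{v\<in>B. f v < f b}. \<exists>a b. (a,b) \<in> Ml \<and> d a b \<le> d u v \<and>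
          (f u \<le> f a \<and> f b \<le> f v \<or> f a \<le> f u \<and> f v \<le> f b)"
      using psubset.IH[OF sub(1) fin(1)] by (elim exE conjE) (rule that; assumption)
    obtain Mr where Mr: "Mr \<subseteq> {u\<in>A. f a < f u} \<times> {v\<in>B. f b < f v}"
      "\<forall>a b a' b'. (a,b) \<in> Mr \<longrightarrow> (a',b') \<in> Mr \<longrightarrow> (a,b) \<noteq> (a',b') \<longrightarrow>
        f a < f a' \<and> f b < f b' \<or> f a' < f a \<and> f b' < f b"
      "\<forall>u\<in>{u\<in>A. f a < f u}. \<forall>v\<in>{v\<in>B. f b < f v}. \<exists>a b. (a,b) \<in> Mr \<and> d a b \<le> d u v \<and>
          (f u \<le> f a \<and> f b \<le> f v \<or> f a \<le> f u \<and> f v \<le> f b)"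
      using psubset.IH[OF sub(2) fin(2)] by (elim exE conjE) (rule that; assumption)
    show ?thesis
    proof (intro exI[of _ "insert (a, b) (Ml \<union> Mr)"] conjI)
      show "insert (a, b) (Ml \<union> Mr) \<subseteq> A \<times> B" using ab Ml(1) Mr(1) by auto
      have L: "f u < f a \<and> f v < f b" if "(u, v) \<in> Ml" for u v using that Ml(1) by auto
      have R: "f a < f u \<and> f b < f v" if "(u, v) \<in> Mr" for u v using that Mr(1) by auto
      show "\<forall>u v u' v'. (u,v) \<in> insert (a, b) (Ml \<union> Mr) \<longrightarrow> (u',v') \<in> insert (a, b) (Ml \<union> Mr) \<longrightarrow>
          (u,v) \<noteq> (u',v') \<longrightarrow> f u < f u' \<and> f v < f v' \<or> f u' < f u \<and> f v' < f v"
      proof (intro allI impI disjCI)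
        fix u v u' v'
        assume "(u, v) \<in> insert (a, b) (Ml \<union> Mr)" "(u', v') \<in> insert (a, b) (Ml \<union> Mr)"
          and ne: "(u, v) \<noteq> (u', v')" and not: "\<not> (f u' < f u \<and> f v' < f v)"
        then consider "(u, v) = (a, b)" | "(u', v') = (a, b)" | "(u, v) \<in> Ml" "(u', v') \<in> Ml"
          | "(u, v) \<in> Mr" "(u', v') \<in> Mr" | "(u, v) \<in> Ml" "(u', v') \<in> Mr" | "(u, v) \<in> Mr" "(u', v') \<in> Ml"
          by blast
        then show "f u < f u' \<and> f v < f v'"
        proof cases
          case 3
          then show ?thesis using Ml(2) ne not by blast
        next
          case 4
          then show ?thesis using Mr(2) ne not by blast
        next
          case 5
          then show ?thesis using L R by (meson less_trans)
        next
          case 6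
          then show ?thesis using L R not by (meson less_trans)
        qed (use \<open>(u, v) \<in> insert _ _\<close> \<open>(u', v') \<in> insert _ _\<close> ne not L[of u v] R[of u v] L[of u' v'] R[of u' v'] in auto)
      qed
      show "\<forall>u\<in>A. \<forall>v\<in>B. \<exists>a' b'. (a',b') \<in> insert (a, b) (Ml \<union> Mr) \<and> d a' b' \<le> d u v \<and>
          (f u \<le> f a' \<and> f b' \<le> f v \<or> f a' \<le> f u \<and> f v \<le> f b')"
      proof (intro ballI)
        fix u v assume uv: "u \<in> A" "v \<in> B"
        consider "f u < f a" "f v < f b" | "f a < f u" "f b < f v"
          | "f u \<le> f a \<and> f b \<le> f v \<or> f a \<le> f u \<and> f v \<le> f b" by linarith
        then show "\<exists>a' b'. (a',b') \<in> insert (a, b) (Ml \<union> Mr) \<and> d a' b' \<le> d u v \<and>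
          (f u \<le> f a' \<and> f b' \<le> f v \<or> f a' \<le> f u \<and> f v \<le> f b')"
        proof cases
          case 1
          then show ?thesis using Ml(3) uv by blast
        next
          case 2
          then show ?thesis using Mr(3) uv by blast
        next
          case 3
          then show ?thesis using closest uv by blast
        qed
      qed
    qed
  qed
qed

subsection \<open>Walks and paths in geometric graphs\<close>

text \<open>Bounds of this form add up along concatenated walks. The infimum and the extended reals
  of \<open>graph_dist\<close> enter only in \<open>stretch_factor_le\<close>.\<close>

definition connects :: "point set set \<Rightarrow> point \<Rightarrow> point \<Rightarrow> real \<Rightarrow> bool" where
  "connects E u v r \<longleftrightarrow> (\<exists>P. is_walk E P \<and> hd P = u \<and> last P = v \<and> walk_length P \<le> r)"

lemma connects_refl: "connects E u u 0"
  unfolding connects_def by (intro exI[of _ "[u]"]) simp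

lemma connects_mono: "connects E u v r \<Longrightarrow> r \<le> r' \<Longrightarrow> connects E u v r'"
  unfolding connects_def by (elim exE conjE, intro exI conjI) (assumption+, rule order_trans)

lemma connects_Cons:
  assumes "{u, v} \<in> E" "connects E v w r"
  shows "connects E u w (dist u v + r)"
proof -
  obtain P where P: "is_walk E P" "hd P = v" "last P = w" "walk_length P \<le> r"
    using assms by (auto simp: connects_def)
  then obtain xs where "P = v # xs" by (cases P) auto
  then show ?thesis
    using P assms unfolding connects_def by (intro exI[of _ "u # P"]) auto
qed

lemma connects_edge: "{u, v} \<in> E \<Longrightarrow> connects E u v (dist u v)"
  using connects_Cons[OF _ connects_refl] by simp

lemma connects_trans:
  assumes "connects E u v r" "connects E v w r'"
  shows "connects E u w (r + r')"
proof -
  \<comment> \<open>Induction on the first walk avoids a plain append, in which the common vertex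
    \<open>v\<close> would occur twice in a row.\<close>
  have *: "connects E (hd P) w (walk_length P + r')" if "is_walk E P" "last P = v" for P
    using that
  proof (induction P rule: induct_list012)
    case (3 x y xs)
    then have "{x, y} \<in> E" "connects E y w (walk_length (y # xs) + r')" by auto
    then show ?case using connects_Cons[of x y E w] by (simp add: add.assoc)
  qed (use assms in auto)
  obtain P where "is_walk E P" "hd P = u" "last P = v" "walk_length P \<le> r"
    using assms(1) unfolding connects_def by blast
  then show ?thesis using connects_mono[OF *[of P]] by simp
qed

lemma connects_sym:
  assumes "connects E u v r"
  shows "connects E v u r"
proof -
  have "connects E (last P) (hd P) (walk_length P)" if "is_walk E P" for P
    using that
  proof (induction P rule: induct_list012)
    case (3 x y xs)
    then have "connects E (last (y # xs)) y (walk_length (y # xs))" by auto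
    moreover have "connects E y x (dist x y)"
      using connects_edge[of y x E] 3 by (simp add: insert_commute dist_commute)
    ultimately show ?case using connects_trans by (fastforce simp: add.commute)
  qed (use connects_refl in auto)
  then show ?thesis
    using assms unfolding connects_def[of E u v] by (meson connects_mono)
qed

lemma stretch_factor_le:
  assumes "\<And>u v. u \<in> S \<Longrightarrow> v \<in> S \<Longrightarrow> connects E u v (t * dist u v)"
  shows "stretch_factor S E \<le> ereal t"
  unfolding stretch_factor_def
proof (rule Inf_lower, clarify)
  fix u v assume "u \<in> S" "v \<in> S"
  then obtain P where P: "is_walk E P" "hd P = u" "last P = v" "walk_length P \<le> t * dist u v"
    using assms[of u v] unfolding connects_def by blast
  then have "graph_dist E u v \<le> ereal (walk_length P)"
    unfolding graph_dist_def by (intro Inf_lower) auto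
  also have "\<dots> \<le> ereal t * ereal (dist u v)" using P by simp
  finally show "graph_dist E u v \<le> ereal t * ereal (dist u v)" .
qed

definition path_edges :: "'a list \<Rightarrow> 'a set set" where
  "path_edges ws = {{ws ! k, ws ! Suc k} | k. Suc k < length ws}"

lemma connects_path:
  assumes "path_edges ws \<subseteq> E" "j < length ws" "i \<le> j"
  shows "connects E (ws ! i) (ws ! j) (\<Sum>k=i..<j. dist (ws ! k) (ws ! Suc k))"
  using assms(3)
proof (induction rule: inc_induct)
  case base
  then show ?case by (simp add: connects_refl)
next
  case (step i)
  then have "{ws ! i, ws ! Suc i} \<in> path_edges ws"
    using assms(2) by (auto simp: path_edges_def)
  then have "{ws ! i, ws ! Suc i} \<in> E" using assms(1) by blast
  then show ?case using connects_Cons step by (simp add: sum.atLeast_Suc_lessThan)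
qed

lemma path_edges_incident:
  assumes "distinct ws" "i < length ws"
  shows "{e \<in> path_edges ws. ws ! i \<in> e} \<subseteq>
    (if 0 < i then {{ws ! (i - 1), ws ! i}} else {}) \<union>
    (if Suc i < length ws then {{ws ! i, ws ! Suc i}} else {})"
  using assms by (auto simp: path_edges_def nth_eq_iff_index_eq)

text \<open>\<open>p\<close> and \<open>q\<close> are ends of both chains; the sharper bound at the
  ends keeps their number of polygon edges at 2.\<close>

lemma card_incident_path_edges:
  assumes "distinct ws" "v \<in> set ws"
  shows "card {e \<in> path_edges ws. v \<in> e} \<le> (if v = hd ws \<or> v = last ws then 1 else 2)"
proof -
  obtain i where i: "i < length ws" "v = ws ! i" using assms by (auto simp: in_set_conv_nth)
  define A where "A = (if 0 < i then {{ws ! (i - 1), ws ! i}} else {})"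
  define B where "B = (if Suc i < length ws then {{ws ! i, ws ! Suc i}} else {})"
  have "card {e \<in> path_edges ws. v \<in> e} \<le> card (A \<union> B)"
    using path_edges_incident[OF assms(1) i(1)] i unfolding A_def B_def
    by (intro card_mono) auto
  also have "\<dots> \<le> card A + card B" by (rule card_Un_le)
  finally have *: "card {e \<in> path_edges ws. v \<in> e} \<le> card A + card B" .
  have "card A \<le> 1" "card B \<le> 1" by (auto simp: A_def B_def)
  moreover have "ws \<noteq> []" using i by auto
  then have "v = hd ws \<longleftrightarrow> i = 0" "v = last ws \<longleftrightarrow> i = length ws - 1"
    using nth_eq_iff_index_eq[OF assms(1), of i 0] nth_eq_iff_index_eq[OF assms(1), of i "length ws - 1"] i
    by (auto simp: hd_conv_nth last_conv_nth)
  then have "v = hd ws \<Longrightarrow> card A = 0" "v = last ws \<Longrightarrow> card B = 0"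
    using i by (auto simp: A_def B_def)
  ultimately show ?thesis using * by auto
qed

lemma exists_strictly_sorted_list:
  fixes f :: "'a \<Rightarrow> real"
  assumes "finite A" "inj_on f A"
  shows "\<exists>ws. set ws = A \<and> sorted_wrt (\<lambda>a b. f a < f b) ws"
proof -
  define ws where "ws = map (the_inv_into A f) (sorted_list_of_set (f ` A))"
  have "set ws = A"
    using assms by (simp add: ws_def image_image the_inv_into_f_f cong: image_cong_simp)
  moreover have "sorted_wrt (\<lambda>a b. f a < f b) ws"
    unfolding ws_def sorted_wrt_map
    by (rule sorted_wrt_mono_rel[OF _ strict_sorted_list_of_set])
       (use assms in \<open>auto simp: f_the_inv_into_f\<close>)
  ultimately show ?thesis by blast
qed

subsection \<open>Crossing segments\<close>

text \<open>Twice the signed area of the triangle, positive if it is counterclockwise.\<close>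

definition orient :: "complex \<Rightarrow> complex \<Rightarrow> complex \<Rightarrow> real" where
  "orient a b c = (Re b - Re a) * (Im c - Im a) - (Im b - Im a) * (Re c - Re a)"

lemma orient_affine:
  "orient a b ((1 - t) *\<^sub>R c + t *\<^sub>R d) = (1 - t) * orient a b c + t * orient a b d"
  by (simp add: orient_def) algebra

text \<open>The signs make the two diagonals cross in a point \<open>z\<close>. The triangle
  inequality through \<open>z\<close> bounds each side by two pieces of the diagonals, and the four
  pieces add up to both diagonals.\<close>

lemma crossing_diagonals:
  assumes "orient b a u > 0" "orient b a v < 0" "orient u v a > 0" "orient u v b < 0"
  shows "cmod (u - a) + cmod (b - v) \<le> cmod (u - v) + cmod (a - b)"
proof -
  \<comment> \<open>\<open>W\<close> is twice the area of the quadrilateral, hence the common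
    denominator for the position of \<open>z\<close> on both diagonals.\<close>
  define W where "W = orient b a u - orient b a v"
  define t s where "t = orient b a u / W" and "s = - orient u v b / W"
  have W: "W > 0" "W = orient u v a - orient u v b"
    using assms by (simp_all add: W_def) (simp add: orient_def algebra_simps)
  have t: "0 \<le> t" "t \<le> 1" using assms W by (simp_all add: t_def W_def)
  have s: "0 \<le> s" "s \<le> 1" using assms W by (simp_all add: s_def field_simps)
  define z where "z = (1 - t) *\<^sub>R u + t *\<^sub>R v"
  have "W *\<^sub>R z = W *\<^sub>R ((1 - s) *\<^sub>R b + s *\<^sub>R a)"
  proof -
    have "W * t = orient b a u" "W * s = - orient u v b" using W by (simp_all add: t_def s_def)
    then show ?thesis
      unfolding z_def complex_eq_iff
      by (simp add: W_def orient_def) algebra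
  qed
  then have z: "z = (1 - s) *\<^sub>R b + s *\<^sub>R a" using W by simp
  have "cmod (u - a) \<le> cmod (u - z) + cmod (z - a)" "cmod (b - v) \<le> cmod (b - z) + cmod (z - v)"
    using norm_triangle_ineq[of "u - z" "z - a"] norm_triangle_ineq[of "b - z" "z - v"] by simp_all
  moreover have "u - z = t *\<^sub>R (u - v)" "z - v = (1 - t) *\<^sub>R (u - v)"
    by (simp_all add: z_def algebra_simps)
  then have "cmod (u - z) = t * cmod (u - v)" "cmod (z - v) = (1 - t) * cmod (u - v)"
    using t by simp_all
  then have "cmod (u - z) + cmod (z - v) = cmod (u - v)" by (simp add: algebra_simps)
  moreover have "z - a = (1 - s) *\<^sub>R (b - a)" "b - z = s *\<^sub>R (b - a)"
    by (simp_all add: z algebra_simps)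
  then have "cmod (z - a) = (1 - s) * cmod (a - b)" "cmod (b - z) = s * cmod (a - b)"
    using s by (simp_all add: norm_minus_commute)
  then have "cmod (z - a) + cmod (b - z) = cmod (a - b)" by (simp add: algebra_simps)
  ultimately show ?thesis by linarith
qed

text \<open>The edge \<open>e\<close> lies on a line that supports the convex hull of \<open>S\<close> and meets \<open>S\<close> only in \<open>e\<close>.\<close>

definition supported :: "point set \<Rightarrow> point set \<Rightarrow> bool" where
  "supported S e \<longleftrightarrow> (\<exists>g :: point \<Rightarrow> real.
     (\<forall>u v t. g ((1 - t) *\<^sub>R u + t *\<^sub>R v) = (1 - t) * g u + t * g v) \<and>
     (\<forall>w\<in>e. g w = 0) \<and> (\<forall>w\<in>S - e. 0 < g w))"

lemma hull_pairE:
  assumes "z \<in> convex hull {c, d :: point}"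
  obtains t where "0 \<le> t" "t \<le> 1" "z = (1 - t) *\<^sub>R c + t *\<^sub>R d"
  using assms unfolding segment_convex_hull[symmetric] by (auto simp: in_segment)

text \<open>The affine function of \<open>supported S e\<close> is nonnegative on the segment
  \<open>e'\<close> and positive at an end point of \<open>e'\<close> outside \<open>e\<close>. So
  it vanishes on that segment at most at the other end point, which must then belong to
  \<open>e\<close>.\<close>

lemma supported_edge_noncrossing:
  assumes "supported S e" "e \<subseteq> S" "card e = 2" "e' \<subseteq> S" "card e' = 2" "e \<noteq> e'"
  shows "convex hull e \<inter> convex hull e' \<subseteq> e \<inter> e'"
proof clarify
  fix z assume z: "z \<in> convex hull e" "z \<in> convex hull e'"
  obtain g :: "point \<Rightarrow> real" where aff: "\<forall>u v t. g ((1 - t) *\<^sub>R u + t *\<^sub>R v) = (1 - t) * g u + t * g v"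
    and "\<forall>w\<in>e. g w = 0" "\<forall>w\<in>S - e. 0 < g w"
    using assms(1) unfolding supported_def by blast
  then have g: "\<And>w. w \<in> e \<Longrightarrow> g w = 0" "\<And>w. w \<in> S \<Longrightarrow> w \<notin> e \<Longrightarrow> 0 < g w" by auto
  obtain a b where ab: "e = {a, b}" using assms by (auto simp: card_2_iff)
  have gz: "g z = 0" using z(1) unfolding ab by (elim hull_pairE) (simp add: aff g ab)
  have "\<exists>c d. e' = {c, d} \<and> d \<notin> e"
  proof -
    obtain c d where cd: "e' = {c, d}" using assms by (auto simp: card_2_iff)
    then have "\<not> e' \<subseteq> e" using assms by (metis card_subset_eq card.infinite zero_neq_numeral)
    then show ?thesis using cd by (auto simp: insert_commute)
  qed
  then obtain c d where cd: "e' = {c, d}" "d \<notin> e" by blast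
  obtain t where t: "0 \<le> t" "t \<le> 1" "z = (1 - t) *\<^sub>R c + t *\<^sub>R d"
    using z(2) unfolding cd by (elim hull_pairE)
  have "(1 - t) * g c + t * g d = 0" using gz t aff by simp
  moreover have gd: "0 < g d" using g cd assms by auto
  moreover have gc: "0 \<le> g c" using g cd assms by (cases "c \<in> e") (auto simp: less_imp_le)
  ultimately have "t * g d = 0" "(1 - t) * g c = 0" using t
    by (smt (verit) mult_nonneg_nonneg)+
  then have "t = 0" "g c = 0" using gd by auto
  then have "z = c" "c \<in> e" using t g(2)[of c] cd assms by auto
  then show "z \<in> e \<inter> e'" using cd by auto
qed

subsection \<open>Points in convex position with a diametral pair\<close>

text \<open>The similarity \<open>\<zeta>\<close> normalizes the diametral pair to 0 and 1. As a
  parameter it can be replaced by its conjugate, so through \<open>reflected\<close> each fact about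
  the upper chain also holds for the lower one.\<close>

locale diameter_frame =
  fixes S :: "point set" and p q :: point and \<zeta> :: "point \<Rightarrow> complex" and R :: real
  assumes fin: "finite S" and convex_pos: "convex_position S"
    and pq: "p \<in> S" "q \<in> S" "\<zeta> p = 0" "\<zeta> q = 1"
    and affine: "\<And>u v t. \<zeta> ((1 - t) *\<^sub>R u + t *\<^sub>R v) = (1 - t) *\<^sub>R \<zeta> u + t *\<^sub>R \<zeta> v"
    and dist_eq: "\<And>u v. dist u v = R * cmod (\<zeta> u - \<zeta> v)" and R: "0 < R"
    and diam: "\<And>u v. u \<in> S \<Longrightarrow> v \<in> S \<Longrightarrow> cmod (\<zeta> u - \<zeta> v) \<le> 1"
begin

abbreviation X where "X w \<equiv> Re (\<zeta> w)"
abbreviation Y where "Y w \<equiv> Im (\<zeta> w)"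

lemma reflected: "diameter_frame S p q (\<lambda>w. cnj (\<zeta> w)) R"
  by unfold_locales
    (auto simp: fin convex_pos pq affine dist_eq R diam complex_cnj_diff[symmetric] simp del: complex_cnj_diff)

lemma inj: "\<zeta> u = \<zeta> v \<Longrightarrow> u = v"
  using dist_eq[of u v] by simp

lemma not_between:
  assumes "w \<in> S" "u \<in> S" "v \<in> S" "w \<noteq> u" "w \<noteq> v" "0 \<le> t" "t \<le> 1"
    "\<zeta> w = (1 - t) *\<^sub>R \<zeta> u + t *\<^sub>R \<zeta> v"
  shows False
proof -
  have "w = (1 - t) *\<^sub>R u + t *\<^sub>R v" using assms by (intro inj) (simp add: affine)
  also have "\<dots> \<in> convex hull (S - {w})"
    using assms by (intro convexD_alt convex_convex_hull) (auto intro: hull_inc)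
  finally show False using convex_pos \<open>w \<in> S\<close> by (auto simp: convex_position_def)
qed

text \<open>\<open>w\<close> lies on the vertical segment between a point \<open>e\<close> of
  \<open>pq\<close> and a point \<open>m\<close> of \<open>uv\<close>, both in the convex hull of
  the points other than \<open>w\<close>.\<close>

lemma not_under_roof:
  assumes S: "w \<in> S" "u \<in> S" "v \<in> S" and ne: "w \<noteq> u" "w \<noteq> v" "w \<noteq> p" "w \<noteq> q" and t: "0 \<le> t" "t \<le> 1"
    and X: "X w = (1 - t) * X u + t * X v" "0 \<le> X w" "X w \<le> 1"
    and Y: "0 \<le> Y w" "Y w \<le> (1 - t) * Y u + t * Y v"
  shows False
proof -
  define m where "m = (1 - t) *\<^sub>R u + t *\<^sub>R v"
  define e where "e = (1 - X w) *\<^sub>R p + X w *\<^sub>R q"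
  have hull: "m \<in> convex hull (S - {w})" "e \<in> convex hull (S - {w})"
    unfolding m_def e_def using assms pq
    by (intro convexD_alt convex_convex_hull; auto intro: hull_inc)+
  have Ym: "Y m = (1 - t) * Y u + t * Y v" and Xm: "X m = X w" using X by (simp_all add: m_def affine)
  have e: "\<zeta> e = of_real (X w)" by (simp add: e_def affine pq complex_eq_iff)
  \<comment> \<open>If \<open>Y m = 0\<close>, division by zero gives \<open>s = 0\<close>, which
    fits because then \<open>Y w = 0\<close> as well.\<close>
  define s where "s = Y w / Y m"
  have s: "0 \<le> s" "s \<le> 1" using Y Ym by (auto simp: s_def divide_le_eq_1)
  have "s * Y m = Y w" using Y Ym by (auto simp: s_def)
  then have "\<zeta> w = \<zeta> ((1 - s) *\<^sub>R e + s *\<^sub>R m)"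
    unfolding affine e by (simp add: complex_eq_iff Xm algebra_simps)
  then have "w = (1 - s) *\<^sub>R e + s *\<^sub>R m" by (rule inj)
  also have "\<dots> \<in> convex hull (S - {w})" using hull s by (intro convexD_alt convex_convex_hull)
  finally show False using convex_pos \<open>w \<in> S\<close> by (auto simp: convex_position_def)
qed

section \<open>Chains on the two sides of \<open>pq\<close>\<close>

lemma lens: "w \<in> S \<Longrightarrow> cmod (\<zeta> w) \<le> 1 \<and> cmod (\<zeta> w - 1) \<le> 1"
  using diam[of w p] diam[of w q] pq by simp

text \<open>The unit disc around 1 meets the half-plane of nonpositive real part only in 0; the disc
  around 0 behaves likewise at 1.\<close>

lemma X_strict:
  assumes "w \<in> S" "w \<noteq> p" "w \<noteq> q"
  shows "0 < X w" "X w < 1"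
proof -
  have "(cmod (\<zeta> w))\<^sup>2 \<le> 1" "(cmod (\<zeta> w - 1))\<^sup>2 \<le> 1"
    using lens[OF assms(1)] by (simp_all add: power_le_one)
  then have 1: "(X w)\<^sup>2 + (Y w)\<^sup>2 \<le> 1" and 2: "(1 - X w)\<^sup>2 + (Y w)\<^sup>2 \<le> 1"
    by (simp_all add: cmod_power2 power2_commute[of 1])
  have no_excess: "d = 1 \<and> y\<^sup>2 = 0" if "1 \<le> d" "d\<^sup>2 + y\<^sup>2 \<le> 1" for d y :: real
  proof -
    have "d \<le> d\<^sup>2" using that by (simp add: self_le_power)
    then have "d \<le> 1" "y\<^sup>2 \<le> 0" using that zero_le_power2[of y] by linarith+
    then show ?thesis using that by simp
  qed
  show "0 < X w"
  proof (rule ccontr)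
    assume "\<not> 0 < X w"
    then have d: "1 \<le> 1 - X w" by simp
    have "1 - X w = 1 \<and> (Y w)\<^sup>2 = 0"
      using no_excess[OF d 2] by simp
    then have "X w = 0" "(Y w)\<^sup>2 = 0" by simp_all
    then have "\<zeta> w = \<zeta> p" by (simp add: complex_eq_iff pq)
    then show False using inj assms by blast
  qed
  show "X w < 1"
  proof (rule ccontr)
    assume "\<not> X w < 1"
    then have "X w = 1" "(Y w)\<^sup>2 = 0" using no_excess[OF _ 1] by simp_all
    then have "\<zeta> w = \<zeta> q" by (simp add: complex_eq_iff pq)
    then show False using inj assms by blast
  qed
qed

lemma X_bounds: "w \<in> S \<Longrightarrow> 0 \<le> X w" "w \<in> S \<Longrightarrow> X w \<le> 1"
  using X_strict[of w] pq by (cases "w = p"; cases "w = q"; simp)+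

lemma Y_nonzero:
  assumes "w \<in> S" "w \<noteq> p" "w \<noteq> q"
  shows "Y w \<noteq> 0"
proof
  assume "Y w = 0"
  then have "\<zeta> w = (1 - X w) *\<^sub>R \<zeta> p + X w *\<^sub>R \<zeta> q" by (simp add: complex_eq_iff pq)
  then show False using not_between[of w p q "X w"] assms X_strict[OF assms] pq by auto
qed

text \<open>\<open>p\<close> and \<open>q\<close> belong to this chain and to its mirror image, the
  lower chain. In the matching they count as upper only, since its other side is
  \<open>S - upper\<close>.\<close>

definition upper where "upper = {w \<in> S. 0 < Y w} \<union> {p, q}"

lemma upperD: "w \<in> upper \<Longrightarrow> w \<in> S" "w \<in> upper \<Longrightarrow> 0 \<le> Y w"
  "w \<in> upper \<Longrightarrow> w \<noteq> p \<Longrightarrow> w \<noteq> q \<Longrightarrow> 0 < Y w"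
  using pq by (auto simp: upper_def)

lemma not_upperD: "w \<in> S \<Longrightarrow> w \<notin> upper \<Longrightarrow> Y w < 0"
  using Y_nonzero[of w] by (auto simp: upper_def)

text \<open>Of two upper points on one vertical line, the lower one lies under the degenerate roof
  that consists of the other.\<close>

lemma inj_on_X: "inj_on X upper"
proof -
  have no: False if "u \<in> upper" "v \<in> upper" "X u = X v" "Y u \<le> Y v" "u \<noteq> v" "u \<noteq> p" "u \<noteq> q" for u v
    using not_under_roof[of u v v 0] that upperD[of u] upperD[of v] X_bounds[of u] by auto
  have *: "u = v" if "u \<in> upper" "v \<in> upper" "X u = X v" "Y u \<le> Y v" for u v
  proof (cases "u = p \<or> u = q")
    case True
    then show ?thesis using that pq X_strict[of v] upperD[of v] by (cases "v = p \<or> v = q") auto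
  qed (use no that in blast)
  show ?thesis
  proof (rule inj_onI)
    fix u v assume "u \<in> upper" "v \<in> upper" "X u = X v"
    then show "u = v" using *[of u v] *[of v u] by (cases "Y u \<le> Y v") auto
  qed
qed

lemma upper_concave:
  assumes "a \<in> upper" "b \<in> upper" "c \<in> upper" "X a < X b" "X b < X c"
  shows "Y a * (X c - X b) + Y c * (X b - X a) < Y b * (X c - X a)"
proof (rule ccontr)
  assume *: "\<not> ?thesis"
  define t where "t = (X b - X a) / (X c - X a)"
  have t: "0 \<le> t" "t \<le> 1" and tm: "t * (X c - X a) = X b - X a" using assms by (simp_all add: t_def)
  have "Y b * (X c - X a) \<le> ((1 - t) * Y a + t * Y c) * (X c - X a)"
  proof -
    have "((1 - t) * Y a + t * Y c) * (X c - X a) = Y a * (X c - X a) + (Y c - Y a) * (t * (X c - X a))"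
      by (simp add: algebra_simps)
    then show ?thesis using * unfolding tm by (simp add: algebra_simps)
  qed
  then have "Y b \<le> (1 - t) * Y a + t * Y c" using assms by simp
  moreover have "X b = (1 - t) * X a + t * X c" using tm by (simp add: algebra_simps)
  moreover have "b \<noteq> a" "b \<noteq> c" using assms by auto
  moreover have "b \<noteq> p" "b \<noteq> q"
    using X_bounds[OF upperD(1)[OF assms(1)]] X_bounds[OF upperD(1)[OF assms(3)]] assms pq by auto
  ultimately show False
    using not_under_roof[of b a c t] t assms upperD[of a] upperD[of b] upperD[of c] X_bounds[of b] by auto
qed

text \<open>Concavity for \<open>p\<close>, \<open>a\<close>, \<open>c\<close> and for
  \<open>a\<close>, \<open>c\<close>, \<open>q\<close>: neither \<open>p\<close> nor
  \<open>q\<close> lies above the line through \<open>a\<close> and \<open>c\<close>.\<close>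

lemma upper_ends:
  assumes "a \<in> upper" "c \<in> upper" "X a < X c"
  shows "Y c * X a \<le> Y a * X c" "Y a * (1 - X c) \<le> Y c * (1 - X a)"
    and "0 < Y a \<Longrightarrow> Y c * X a < Y a * X c" "0 < Y c \<Longrightarrow> Y a * (1 - X c) < Y c * (1 - X a)"
proof -
  have p: "Y c * X a < Y a * X c" if "a \<noteq> p"
  proof -
    have "a \<noteq> q" using assms X_bounds[of c] upperD pq by auto
    then show ?thesis
      using upper_concave[of p a c] assms X_strict[of a] upperD(1)[of a] that pq
      by (auto simp: upper_def)
  qed
  have q: "Y a * (1 - X c) < Y c * (1 - X a)" if "c \<noteq> q"
  proof -
    have "c \<noteq> p" using assms X_bounds[of a] upperD pq by auto
    then show ?thesis
      using upper_concave[of a c q] assms X_strict[of c] upperD(1)[of c] that pq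
      by (auto simp: upper_def)
  qed
  show "Y c * X a \<le> Y a * X c" using p pq by (cases "a = p") auto
  show "Y a * (1 - X c) \<le> Y c * (1 - X a)" using q pq by (cases "c = q") auto
  show "0 < Y a \<Longrightarrow> Y c * X a < Y a * X c" using p pq by (cases "a = p") auto
  show "0 < Y c \<Longrightarrow> Y a * (1 - X c) < Y c * (1 - X a)" using q pq by (cases "c = q") auto
qed

text \<open>By \<open>upper_ends\<close> the segment \<open>pq\<close> is nowhere above the line
  \<open>ac\<close>, and \<open>b\<close> is not above the point of \<open>pq\<close> with the same
  abscissa. The last hypothesis makes one of the two comparisons strict.\<close>

lemma orient_below:
  assumes "a \<in> upper" "c \<in> upper" "X a < X c" and b: "b \<in> S" "Y b \<le> 0"
    and "Y b < 0 \<or> 0 < Y a \<and> 0 < Y c"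
  shows "orient (\<zeta> b) (\<zeta> a) (\<zeta> c) < 0"
proof -
  define A B where "A = Y a * X c - Y c * X a" and "B = Y c * (1 - X a) - Y a * (1 - X c)"
  have A: "0 \<le> A" and B: "0 \<le> B" using upper_ends[OF assms(1-3)] by (simp_all add: A_def B_def)
  have "orient (\<zeta> b) (\<zeta> a) (\<zeta> c) = Y b * (X c - X a) - ((1 - X b) * A + X b * B)"
    by (simp add: orient_def A_def B_def algebra_simps)
  moreover have "Y b * (X c - X a) \<le> 0" using assms by (simp add: mult_nonpos_nonneg)
  moreover have "0 \<le> (1 - X b) * A + X b * B" using A B X_bounds[OF b(1)] by simp
  moreover have "Y b * (X c - X a) < 0 \<or> 0 < (1 - X b) * A + X b * B"
  proof (cases "Y b < 0")
    case True
    then show ?thesis using assms by (simp add: mult_neg_pos)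
  next
    case False
    then have "0 < A" "0 < B" using assms upper_ends[OF assms(1-3)] by (simp_all add: A_def B_def)
    then show ?thesis using X_bounds[OF b(1)] 
      by (cases "X b = 0") (auto intro!: add_nonneg_pos)
  qed
  ultimately show ?thesis by linarith
qed

lemma upper_list:
  obtains ws where "set ws = upper" "sorted_wrt (\<lambda>a b. X a < X b) ws" "distinct ws"
    "hd ws = p" "last ws = q" "ws \<noteq> []"
proof -
  have "finite upper" using fin by (auto simp: upper_def)
  then obtain ws where ws: "set ws = upper" "sorted_wrt (\<lambda>a b. X a < X b) ws"
    using exists_strictly_sorted_list inj_on_X by blast
  have ne: "ws \<noteq> []" using ws by (auto simp: upper_def)
  have "distinct ws"
    using ws(2) by (auto simp: distinct_conv_nth sorted_wrt_iff_nth_less) (metis less_irrefl linorder_neqE_nat)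
  have "hd ws = p"
  proof (rule ccontr)
    assume *: "hd ws \<noteq> p"
    obtain y ys where ys: "ws = y # ys" using ne by (cases ws) auto
    then have "p \<in> set ys" using * ws by (auto simp: upper_def)
    then have "X y < 0" using ws ys pq by auto
    then show False using X_bounds(1)[of y] upperD(1)[of y] ws ys by auto
  qed
  moreover have "last ws = q"
  proof (rule ccontr)
    assume *: "last ws \<noteq> q"
    obtain y ys where ys: "ws = ys @ [y]" using ne by (cases ws rule: rev_cases) auto
    then have "q \<in> set ys" using * ws by (auto simp: upper_def)
    then have "1 < X y" using ws ys pq by (auto simp: sorted_wrt_append)
    then show False using X_bounds(2)[of y] upperD(1)[of y] ws ys by auto
  qed
  ultimately show ?thesis using that ws ne \<open>distinct ws\<close> by blast
qed

lemma chain_connects: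
  assumes ws: "set ws = upper" "sorted_wrt (\<lambda>a b. X a < X b) ws" "hd ws = p" "last ws = q" "ws \<noteq> []"
    and E: "path_edges ws \<subseteq> E" and uv: "u \<in> upper" "v \<in> upper"
  shows "connects E u v (2*pi/3 * dist u v)"
proof -
  have *: "connects E (ws ! i) (ws ! j) (2*pi/3 * dist (ws ! i) (ws ! j))" if ij: "i \<le> j" "j < length ws" for i j
  proof -
    define n where "n = length ws - 1"
    have "0 < length ws" using ws(5) by simp
    have less: "k < length ws" if "k \<le> n" for k
      using that \<open>0 < length ws\<close> unfolding n_def by linarith
    have up: "ws ! k \<in> upper" if "k \<le> n" for k
      using nth_mem[OF less[OF that]] unfolding ws(1) .
    have mono: "X (ws ! i) < X (ws ! j)" if "i < j" "j \<le> n" for i j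
      by (rule sorted_wrt_nth_less[OF ws(2) that(1) less[OF that(2)]])
    have "(\<Sum>k=i..<j. cmod (\<zeta> (ws ! Suc k) - \<zeta> (ws ! k))) \<le> 2*pi/3 * cmod (\<zeta> (ws ! j) - \<zeta> (ws ! i))"
    proof (rule concave_chain_stretch[where n = n])
      show "\<zeta> (ws ! 0) = 0" "\<zeta> (ws ! n) = 1"
        using ws(3,4) pq hd_conv_nth[OF ws(5)] last_conv_nth[OF ws(5)] by (simp_all add: n_def)
      show "(Y (ws ! k) - Y (ws ! j)) * (X (ws ! j) - X (ws ! i))
          \<le> (Y (ws ! j) - Y (ws ! i)) * (X (ws ! k) - X (ws ! j))" if "i < j" "j < k" "k \<le> n" for i j k
      proof -
        have "Y (ws ! i) * (X (ws ! k) - X (ws ! j)) + Y (ws ! k) * (X (ws ! j) - X (ws ! i))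
            < Y (ws ! j) * (X (ws ! k) - X (ws ! i))"
          by (rule upper_concave) (use that up mono in auto)
        then show ?thesis by (simp add: algebra_simps)
      qed
      show "X (ws ! i) < X (ws ! j)" if "i < j" "j \<le> n" for i j using mono that .
      show "0 \<le> Y (ws ! k)" "cmod (\<zeta> (ws ! k)) \<le> 1 \<and> cmod (\<zeta> (ws ! k) - 1) \<le> 1" if "k \<le> n" for k
        using upperD[OF up[OF that]] lens by simp_all
      show "i \<le> j" "j \<le> n" using ij by (simp_all add: n_def)
    qed
    then have "R * (\<Sum>k=i..<j. cmod (\<zeta> (ws ! Suc k) - \<zeta> (ws ! k))) \<le> R * (2*pi/3 * cmod (\<zeta> (ws ! j) - \<zeta> (ws ! i)))"
      using R by (intro mult_left_mono) auto
    moreover have "cmod (\<zeta> u - \<zeta> v) = cmod (\<zeta> v - \<zeta> u)" for u v by (rule norm_minus_commute)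
    ultimately have "(\<Sum>k=i..<j. dist (ws ! k) (ws ! Suc k)) \<le> 2*pi/3 * dist (ws ! i) (ws ! j)"
      unfolding dist_eq sum_distrib_left by (simp add: mult.left_commute)
    then show ?thesis using connects_path[OF E ij(2,1)] connects_mono by blast
  qed
  have "u \<in> set ws" "v \<in> set ws" using uv ws(1) by simp_all
  then obtain i j where "u = ws ! i" "v = ws ! j" "i < length ws" "j < length ws"
    by (auto simp: in_set_conv_nth)
  then show ?thesis
    using *[of i j] *[of j i] connects_sym by (cases "i \<le> j") (auto simp: dist_commute)
qed

text \<open>No upper vertex lies between two consecutive ones, so concavity puts all other upper
  vertices strictly below their line. The remaining points are strictly below \<open>pq\<close>,
  which is nowhere above that line.\<close>

lemma path_edges_supported:
  assumes ws: "set ws = upper" "sorted_wrt (\<lambda>a b. X a < X b) ws" and e: "e \<in> path_edges ws"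
  shows "supported S e \<and> e \<subseteq> S \<and> card e = 2"
proof -
  obtain k where k: "Suc k < length ws" "e = {ws ! k, ws ! Suc k}" using e by (auto simp: path_edges_def)
  define a b where "a = ws ! k" and "b = ws ! Suc k"
  have ab: "a \<in> upper" "b \<in> upper" "X a < X b" "e = {a, b}"
    using k ws by (auto simp: a_def b_def sorted_wrt_iff_nth_less)
  have consecutive: "X w \<le> X a \<or> X b \<le> X w" if "w \<in> upper" for w
  proof -
    have "w \<in> set ws" using that ws(1) by simp
    then obtain m where m: "m < length ws" "w = ws ! m" by (auto simp: in_set_conv_nth)
    consider "m < k" | "m = k" | "m = Suc k" | "Suc k < m" by linarith
    then show ?thesis
    proof cases
      case 1
      then show ?thesis using sorted_wrt_nth_less[OF ws(2), of m k] m k by (simp add: a_def)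
    next
      case 4
      then show ?thesis using sorted_wrt_nth_less[OF ws(2), of "Suc k" m] m k by (simp add: b_def)
    qed (use m in \<open>auto simp: a_def b_def\<close>)
  qed
  have pos: "orient (\<zeta> b) (\<zeta> a) (\<zeta> w) > 0" if w: "w \<in> S" "w \<noteq> a" "w \<noteq> b" for w
  proof (cases "w \<in> upper")
    case True
    then have "X w \<noteq> X a" "X w \<noteq> X b" using inj_onD[OF inj_on_X] ab w by blast+
    then consider "X w < X a" | "X b < X w" using consecutive[OF True] by linarith
    then show ?thesis
      using upper_concave[of w a b] upper_concave[of a b w] True ab
      by cases (simp_all add: orient_def algebra_simps)
  next
    case False
    have "0 \<le> (1 - X w) * (Y a * X b - Y b * X a)" "0 \<le> X w * (Y b * (1 - X a) - Y a * (1 - X b))"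
      using upper_ends[OF ab(1-3)] X_bounds[OF w(1)] by simp_all
    moreover have "Y w * (X b - X a) < 0" using not_upperD[OF w(1) False] ab by (simp add: mult_neg_pos)
    moreover have "orient (\<zeta> b) (\<zeta> a) (\<zeta> w) = (1 - X w) * (Y a * X b - Y b * X a)
        + X w * (Y b * (1 - X a) - Y a * (1 - X b)) - Y w * (X b - X a)"
      by (simp add: orient_def algebra_simps)
    ultimately show ?thesis by linarith
  qed
  have "supported S e"
    unfolding supported_def
    by (rule exI[of _ "\<lambda>w. orient (\<zeta> b) (\<zeta> a) (\<zeta> w)"])
       (use pos ab in \<open>auto simp: affine orient_affine, auto simp: orient_def\<close>)
  moreover have "a \<noteq> b" using ab by auto
  ultimately show ?thesis using ab upperD by auto
qed

section \<open>Matching edges between the chains\<close>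

lemma not_upper_reflected:
  assumes "w \<in> S - upper"
  shows "w \<in> diameter_frame.upper S p q (\<lambda>w. cnj (\<zeta> w))"
  using assms not_upperD[of w] by (auto simp: diameter_frame.upper_def[OF reflected])

lemma orient_above:
  assumes "b \<in> S - upper" "d \<in> S - upper" "X b < X d" "a \<in> upper"
  shows "orient (\<zeta> b) (\<zeta> a) (\<zeta> d) < 0"
proof -
  \<comment> \<open>Conjugation reverses the orientation, and so does swapping the first two
    arguments.\<close>
  have "orient (cnj (\<zeta> a)) (cnj (\<zeta> b)) (cnj (\<zeta> d)) < 0"
    by (rule diameter_frame.orient_below[OF reflected])
       (use assms not_upper_reflected not_upperD upperD in auto)
  then show ?thesis by (simp add: orient_def algebra_simps)
qed

text \<open>Both \<open>c\<close> and \<open>d\<close> lie strictly to the right of the line from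
  \<open>b\<close> to \<open>a\<close>, by \<open>orient_below\<close> and
  \<open>orient_above\<close>.\<close>

lemma matching_edges_disjoint:
  assumes "a \<in> upper" "c \<in> upper" "b \<in> S - upper" "d \<in> S - upper" "X a < X c" "X b < X d"
  shows "convex hull {a, b} \<inter> convex hull {c, d} = {}"
proof -
  define g where "g w = orient (\<zeta> b) (\<zeta> a) (\<zeta> w)" for w
  have aff: "g ((1 - t) *\<^sub>R u + t *\<^sub>R v) = (1 - t) * g u + t * g v" for t u v
    by (simp only: g_def affine orient_affine)
  have "g z = 0" if "z \<in> convex hull {a, b}" for z
    using that by (elim hull_pairE) (simp add: aff, simp add: g_def orient_def)
  moreover have "g z < 0" if z: "z \<in> convex hull {c, d}" for z
  proof -
    have "g c < 0" unfolding g_def using assms not_upperD[of b] by (intro orient_below) auto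
    moreover have "g d < 0" unfolding g_def using assms by (intro orient_above) auto
    moreover obtain t where t: "0 \<le> t" "t \<le> 1" "z = (1 - t) *\<^sub>R c + t *\<^sub>R d" using z by (elim hull_pairE)
    ultimately have "(1 - t) * g c \<le> 0" "t * g d \<le> 0" "(1 - t) * g c < 0 \<or> t * g d < 0"
      by (auto simp: mult_nonneg_nonpos) (cases "t = 0"; simp add: mult_pos_neg)
    then show ?thesis unfolding t aff by linarith
  qed
  ultimately show ?thesis by force
qed

text \<open>The order of the abscissae makes \<open>uv\<close> and \<open>ab\<close> the crossing
  diagonals of a quadrilateral. A tie identifies two vertices, and the triangle inequality
  remains.\<close>

lemma separating_edge_detour:
  assumes up: "u \<in> upper" "a \<in> upper" and lo: "b \<in> S - upper" "v \<in> S - upper" and X: "X u \<le> X a" "X b \<le> X v"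
  shows "dist u a + dist b v \<le> dist u v + dist a b"
proof -
  consider "u = a" | "b = v" | "u \<noteq> a" "b \<noteq> v" by blast
  then show ?thesis
  proof cases
    case 1
    then show ?thesis using dist_triangle3[of b v a] by (simp add: dist_commute)
  next
    case 2
    then show ?thesis using dist_triangle2[of u a b] by (simp add: dist_commute)
  next
    case 3
    have "X u < X a" using X 3 inj_onD[OF inj_on_X _ up] by fastforce
    moreover have "X b < X v"
      using X 3 inj_onD[OF diameter_frame.inj_on_X[OF reflected], of b v] not_upper_reflected lo by fastforce
    ultimately have "orient (\<zeta> b) (\<zeta> a) (\<zeta> v) < 0" "orient (\<zeta> b) (\<zeta> u) (\<zeta> v) < 0"
      using orient_above up lo by blast+
    moreover have "orient (\<zeta> w) (\<zeta> u) (\<zeta> a) < 0" if "w \<in> S - upper" for w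
      using that not_upperD[of w] \<open>X u < X a\<close> up by (intro orient_below) auto
    then have "orient (\<zeta> b) (\<zeta> u) (\<zeta> a) < 0" "orient (\<zeta> v) (\<zeta> u) (\<zeta> a) < 0"
      using lo by blast+
    ultimately have "cmod (\<zeta> u - \<zeta> a) + cmod (\<zeta> b - \<zeta> v) \<le> cmod (\<zeta> u - \<zeta> v) + cmod (\<zeta> a - \<zeta> b)"
      by (intro crossing_diagonals) (simp_all add: orient_def algebra_simps)
    then have "R * (cmod (\<zeta> u - \<zeta> a) + cmod (\<zeta> b - \<zeta> v)) \<le> R * (cmod (\<zeta> u - \<zeta> v) + cmod (\<zeta> a - \<zeta> b))"
      using R by (intro mult_left_mono) auto
    then show ?thesis by (simp add: dist_eq distrib_left)
  qed
qed

theorem spanner_exists: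
  "\<exists>E. geometric_graph S E \<and> plane_graph E \<and> stretch_factor S E \<le> ereal ((3 + 4 * pi) / 3)
     \<and> (\<forall>v\<in>S. degree E v \<le> 3)"
proof -
  define lower where "lower = diameter_frame.upper S p q (\<lambda>w. cnj (\<zeta> w))"
  have lower_eq: "lower = {w \<in> S. Y w < 0} \<union> {p, q}"
    by (simp add: lower_def diameter_frame.upper_def[OF reflected])
  obtain us where us: "set us = upper" "sorted_wrt (\<lambda>a b. X a < X b) us" "distinct us"
    "hd us = p" "last us = q" "us \<noteq> []"
    using upper_list by blast
  obtain ls where ls: "set ls = lower" "sorted_wrt (\<lambda>a b. X a < X b) ls" "distinct ls"
    "hd ls = p" "last ls = q" "ls \<noteq> []"
    using diameter_frame.upper_list[OF reflected] unfolding lower_def by auto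
  have "finite upper" "finite (S - upper)" using fin by (auto simp: upper_def)
  from closest_pair_matching[OF this, of X dist]
  obtain M where M: "M \<subseteq> upper \<times> (S - upper)"
    and M2: "\<forall>a b a' b'. (a,b) \<in> M \<longrightarrow> (a',b') \<in> M \<longrightarrow> (a,b) \<noteq> (a',b') \<longrightarrow>
        X a < X a' \<and> X b < X b' \<or> X a' < X a \<and> X b' < X b"
    and M3: "\<forall>u\<in>upper. \<forall>v\<in>S - upper. \<exists>a b. (a,b) \<in> M \<and> dist a b \<le> dist u v \<and>
        (X u \<le> X a \<and> X b \<le> X v \<or> X a \<le> X u \<and> X v \<le> X b)"
    by (elim exE conjE) (rule that; assumption)
  have order: "X a < X a' \<and> X b < X b' \<or> X a' < X a \<and> X b' < X b"
    if "(a,b) \<in> M" "(a',b') \<in> M" "(a,b) \<noteq> (a',b')" for a b a' b'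
    by (rule M2[rule_format, OF that])
  define N where "N = (\<lambda>(a, b). {a, b}) ` M"
  define H where "H = path_edges us \<union> path_edges ls"
  define E where "E = H \<union> N"
  have H: "supported S e" "e \<subseteq> S" "card e = 2" if "e \<in> H" for e
    using that path_edges_supported[OF us(1,2)] diameter_frame.path_edges_supported[OF reflected, of ls] ls
    unfolding H_def lower_def by auto
  have N: "\<exists>a b. e = {a, b} \<and> (a, b) \<in> M \<and> a \<in> upper \<and> b \<in> S - upper" if "e \<in> N" for e
    using that M by (auto simp: N_def)
  have E: "e \<subseteq> S \<and> card e = 2" if e: "e \<in> E" for e
  proof (cases "e \<in> H")
    case True
    then show ?thesis using H by blast
  next
    case False
    then have "e \<in> N" using e by (simp add: E_def)
    then obtain a b where "e = {a, b}" "a \<in> upper" "b \<in> S - upper" using N by blast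
    moreover from this have "a \<noteq> b" by auto
    ultimately show ?thesis using upperD by auto
  qed
  then have "geometric_graph S E" by (simp add: geometric_graph_def)
  moreover have "plane_graph E"
    unfolding plane_graph_def
  proof (intro ballI impI)
    fix e1 e2 assume e: "e1 \<in> E" "e2 \<in> E" "e1 \<noteq> e2"
    consider "e1 \<in> H" | "e2 \<in> H" | "e1 \<in> N" "e2 \<in> N" using e by (auto simp: E_def)
    then show "convex hull e1 \<inter> convex hull e2 \<subseteq> e1 \<inter> e2"
    proof cases
      case 1
      then show ?thesis using supported_edge_noncrossing[of S e1 e2] H E e by blast
    next
      case 2
      then show ?thesis using supported_edge_noncrossing[of S e2 e1] H E e by blast
    next
      case 3
      obtain a b where ab: "e1 = {a, b}" "(a, b) \<in> M" "a \<in> upper" "b \<in> S - upper" using N 3 by blast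
      obtain c d where cd: "e2 = {c, d}" "(c, d) \<in> M" "c \<in> upper" "d \<in> S - upper" using N 3 by blast
      have "(a, b) \<noteq> (c, d)" using ab cd e by auto
      then show ?thesis
        using order[OF ab(2) cd(2)] matching_edges_disjoint[of a c b d] matching_edges_disjoint[of c a d b] ab cd
        by blast
    qed
  qed
  moreover have "degree E v \<le> 3" if v: "v \<in> S" for v
  proof -
    have fin_E: "finite {e \<in> F. v \<in> e}" if "F \<subseteq> E" for F
    proof (rule finite_subset)
      show "{e \<in> F. v \<in> e} \<subseteq> Pow S" using that E by blast
    qed (use fin in simp)
    have "{e \<in> E. v \<in> e} = ({e \<in> path_edges us. v \<in> e} \<union> {e \<in> path_edges ls. v \<in> e}) \<union> {e \<in> N. v \<in> e}"
      by (auto simp: E_def H_def)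
    then have "degree E v \<le> card ({e \<in> path_edges us. v \<in> e} \<union> {e \<in> path_edges ls. v \<in> e}) + card {e \<in> N. v \<in> e}"
      unfolding degree_def by (simp only: card_Un_le)
    also have "\<dots> \<le> card {e \<in> path_edges us. v \<in> e} + card {e \<in> path_edges ls. v \<in> e} + card {e \<in> N. v \<in> e}"
      by (intro add_right_mono card_Un_le)
    finally have "degree E v \<le> card {e \<in> path_edges us. v \<in> e} + card {e \<in> path_edges ls. v \<in> e} + card {e \<in> N. v \<in> e}" .
    moreover have "card {e \<in> N. v \<in> e} \<le> 1"
    proof -
      have "e = e'" if e: "e \<in> N" "v \<in> e" "e' \<in> N" "v \<in> e'" for e e'
      proof -
        obtain a b where ab: "e = {a, b}" "(a, b) \<in> M" "a \<in> upper" "b \<in> S - upper" using N e by blast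
        obtain c d where cd: "e' = {c, d}" "(c, d) \<in> M" "c \<in> upper" "d \<in> S - upper" using N e by blast
        have "a = c \<or> b = d" using e ab cd by auto
        then show ?thesis using order[OF ab(2) cd(2)] ab cd by auto
      qed
      then show ?thesis using fin_E[of N] by (simp add: card_le_Suc0_iff_eq E_def)
    qed
    moreover have "card {e \<in> path_edges us. v \<in> e} + card {e \<in> path_edges ls. v \<in> e} \<le> 2"
    proof -
      have empty: "{e \<in> path_edges ws. v \<in> e} = {}" if "v \<notin> set ws" for ws
        using that by (auto simp: path_edges_def)
      have "v \<in> set us \<or> v \<in> set ls" using v not_upperD[of v] us ls lower_eq by auto
      moreover have "v = p \<or> v = q" if "v \<in> set us" "v \<in> set ls"
        using that us ls lower_eq by (auto simp: upper_def)
      ultimately consider "v = p \<or> v = q" "v \<in> set us" "v \<in> set ls" | "v \<in> set us" "v \<notin> set ls" | "v \<in> set ls" "v \<notin> set us"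
        by blast
      then show ?thesis
      proof cases
        case 1
        then show ?thesis
          using card_incident_path_edges[OF us(3), of v] card_incident_path_edges[OF ls(3), of v] us ls by auto
      next
        case 2
        then have "card {e \<in> path_edges us. v \<in> e} \<le> 2"
          using card_incident_path_edges[OF us(3), of v] by (simp split: if_splits)
        then show ?thesis unfolding empty[OF 2(2)] by simp
      next
        case 3
        then have "card {e \<in> path_edges ls. v \<in> e} \<le> 2"
          using card_incident_path_edges[OF ls(3), of v] by (simp split: if_splits)
        then show ?thesis unfolding empty[OF 3(2)] by simp
      qed
    qed
    ultimately show ?thesis by linarith
  qed
  moreover have "stretch_factor S E \<le> ereal ((3 + 4 * pi) / 3)"
  proof (rule stretch_factor_le)
    have upper_path: "connects E u v (2*pi/3 * dist u v)" if "u \<in> upper" "v \<in> upper" for u v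
      using chain_connects[OF us(1,2,4-6) _ that] by (simp add: E_def H_def le_supI1)
    have lower_path: "connects E u v (2*pi/3 * dist u v)" if "u \<in> lower" "v \<in> lower" for u v
      using diameter_frame.chain_connects[OF reflected, of ls E u v] ls that
      unfolding lower_def by (simp add: E_def H_def le_supI1)
    have le: "2*pi/3 * dist u v \<le> (3 + 4 * pi) / 3 * dist u v" for u v :: point
      by (intro mult_right_mono) auto
    have mixed: "connects E u v ((3 + 4 * pi) / 3 * dist u v)" if u: "u \<in> upper" and v: "v \<in> S - upper" for u v
    proof -
      obtain a b where ab: "(a, b) \<in> M" "dist a b \<le> dist u v"
        and side: "X u \<le> X a \<and> X b \<le> X v \<or> X a \<le> X u \<and> X v \<le> X b"
        using M3 u v by blast
      have a: "a \<in> upper" and b: "b \<in> S - upper" using ab M by auto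
      have "{a, b} \<in> E" using ab by (force simp: E_def N_def)
      then have "connects E u v (2*pi/3 * dist u a + (dist a b + 2*pi/3 * dist b v))"
        using u v a b not_upper_reflected
        by (intro connects_trans[OF upper_path connects_trans[OF connects_edge lower_path]])
           (auto simp: lower_def)
      \<comment> \<open>The two possible sides of the matching edge differ by exchanging the
        diagonals \<open>uv\<close> and \<open>ab\<close>.\<close>
      moreover have "dist u a + dist b v \<le> 2 * dist u v"
        using separating_edge_detour[of u a b v] separating_edge_detour[of a u v b] u v a b side ab(2)
        by (auto simp: dist_commute)
      then have "2*pi/3 * (dist u a + dist b v) \<le> 2*pi/3 * (2 * dist u v)"
        by (intro mult_left_mono) auto
      then have "2*pi/3 * dist u a + (dist a b + 2*pi/3 * dist b v) \<le> (3 + 4 * pi) / 3 * dist u v"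
        using ab(2) by (simp add: field_simps)
      ultimately show ?thesis by (rule connects_mono)
    qed
    fix u v assume "u \<in> S" "v \<in> S"
    then consider "u \<in> upper" "v \<in> upper" | "u \<in> lower" "v \<in> lower"
      | "u \<in> upper" "v \<in> S - upper" | "v \<in> upper" "u \<in> S - upper"
      using not_upper_reflected unfolding lower_def by blast
    then show "connects E u v ((3 + 4 * pi) / 3 * dist u v)"
    proof cases
      case 1
      then show ?thesis by (rule connects_mono[OF upper_path le])
    next
      case 2
      then show ?thesis by (rule connects_mono[OF lower_path le])
    next
      case 3
      then show ?thesis by (rule mixed)
    next
      case 4
      show ?thesis using connects_sym[OF mixed[OF 4]] by (simp only: dist_commute[of v u])
    qed
  qed
  ultimately show ?thesis by blast
qed

end

section \<open>Normalization of a diametral pair\<close>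

lemma exists_diameter_frame:
  assumes "finite S" "convex_position S" "\<not> card S \<le> 1"
  obtains p q \<zeta> R where "diameter_frame S p q \<zeta> R"
proof -
  obtain x y where xy: "x \<in> S" "y \<in> S" "x \<noteq> y"
    using assms by (metis One_nat_def card_le_Suc0_iff_eq)
  define D where "D = (\<lambda>(u, v). dist u v) ` (S \<times> S)"
  have D: "finite D" "D \<noteq> {}" using assms xy by (auto simp: D_def)
  then have "Max D \<in> D" by simp
  then obtain p q where pq: "p \<in> S" "q \<in> S" "dist p q = Max D" by (auto simp: D_def)
  have max: "dist u v \<le> dist p q" if "u \<in> S" "v \<in> S" for u v
    unfolding pq(3) using D that by (intro Max_ge) (auto simp: D_def)
  have "p \<noteq> q" using max[OF xy(1,2)] xy by auto
  define c where "c w = Complex (w $ 1) (w $ 2)" for w :: point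
  have c_dist: "dist u v = cmod (c u - c v)" for u v
    by (simp add: c_def dist_vec_def L2_set_def UNIV_2 sum_2 dist_real_def cmod_def)
  have ne: "c q - c p \<noteq> 0" using c_dist[of q p] \<open>p \<noteq> q\<close> by auto
  \<comment> \<open>Division by \<open>c q - c p\<close> is a rotation combined with a scaling that
    divides distances by \<open>dist p q\<close>.\<close>
  define \<zeta> where "\<zeta> w = (c w - c p) / (c q - c p)" for w
  have diff: "\<zeta> u - \<zeta> v = (c u - c v) / (c q - c p)" for u v
    by (simp add: \<zeta>_def diff_divide_distrib)
  have dist: "dist u v = dist p q * cmod (\<zeta> u - \<zeta> v)" for u v
    using ne by (simp add: diff norm_divide c_dist norm_minus_commute)
  have "diameter_frame S p q \<zeta> (dist p q)"
  proof
    show "\<zeta> ((1 - t) *\<^sub>R u + t *\<^sub>R v) = (1 - t) *\<^sub>R \<zeta> u + t *\<^sub>R \<zeta> v" for u v t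
    proof -
      have "c ((1 - t) *\<^sub>R u + t *\<^sub>R v) - c p = (1 - t) *\<^sub>R (c u - c p) + t *\<^sub>R (c v - c p)"
        by (simp add: c_def complex_eq_iff algebra_simps)
      then show ?thesis by (simp add: \<zeta>_def add_divide_distrib scaleR_conv_of_real)
    qed
    show "cmod (\<zeta> u - \<zeta> v) \<le> 1" if "u \<in> S" "v \<in> S" for u v
      using max[OF that] ne unfolding dist[of u v] using \<open>p \<noteq> q\<close> by simp
    show "dist u v = dist p q * cmod (\<zeta> u - \<zeta> v)" for u v by (rule dist)
    show "0 < dist p q" using \<open>p \<noteq> q\<close> by simp
  qed (use assms pq ne \<open>p \<noteq> q\<close> in \<open>auto simp: \<zeta>_def\<close>)
  then show ?thesis by (rule that)
qed

theorem theorem3: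
  fixes S :: "point set"
  assumes "finite S" and "convex_position S"
  shows "\<exists>E. geometric_graph S E \<and> plane_graph E
            \<and> stretch_factor S E \<le> ereal ((3 + 4 * pi) / 3)
            \<and> (\<forall>v\<in>S. degree E v \<le> 3)"
proof (cases "card S \<le> 1")
  case True
  then have "u = v" if "u \<in> S" "v \<in> S" for u v
    using that assms by (simp add: card_le_Suc0_iff_eq)
  then have "stretch_factor S {} \<le> ereal ((3 + 4 * pi) / 3)"
    using connects_refl by (intro stretch_factor_le) fastforce
  then show ?thesis
    by (intro exI[of _ "{}"]) (simp add: geometric_graph_def plane_graph_def degree_def)
next
  case False
  then obtain p q \<zeta> R where "diameter_frame S p q \<zeta> R"
    using exists_diameter_frame assms by blast
  then show ?thesis by (rule diameter_frame.spanner_exists)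
qed

end
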